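(* Let $q$ be a power of a prime $p$ and let $h(x) = x^{10} + a_1x^9 + a_2x^8 + a_3x^7 + a_4x^6 + a_5x^5 + a_4qx^4 + a_3q^2x^3 + a_2q^3x^2 + a_1q^4x + q^5$ with $a_1,\dots,a_5 \in \mathbb{Z}$. Define $u_2 = -\frac{3a_1^2}{25} + \frac{3a_2}{10} - \frac{3q}{2}$, $u_3 = \frac{2a_1^3}{125} - \frac{3a_1a_2}{50} - \frac{qa_1}{10} + \frac{a_3}{10}$, $u_4 = -\frac{3a_1^4}{625} + \frac{3a_1^2a_2}{125} + \frac{qa_1^2}{5} - \frac{2a_1a_3}{25} - \frac{3qa_2}{5} + \frac{a_4}{5} + q^2$, $\Delta = u_3^2 + \frac{4}{27}u_2^3$, and $S = \left\{ -\zeta^k\omega\left(\frac{9u_3}{2} + \frac{3\sqrt{\Delta}}{2}\right) - \zeta^{-k}\bar\omega\left(\frac{9u_3}{2} - \frac{3\sqrt{\Delta}}{2}\right) + \frac{2u_2^2}{3} : 0 \leq k \leq 2\right\}$, where $\zeta$ is a primitive third root of unity, $\sqrt{\Delta}$ a complex square root of $\Delta$ and $\omega$ a complex third root of $\frac12(-u_3 + \sqrt{\Delta})$. Consider: (a) $|a_1| \leq 10\sqrt{q}$; (b* ) $8\sqrt{q}\,|a_1| - 35q \leq a_2$; (b) $a_2 \leq \frac25 a_1^2 + 5q$; (c) $-\frac{4}{25}a_1^3 + \frac35 a_1a_2 + qa_1 - \frac{1}{50}(4a_1^2 + 50q - 10a_2)^{3/2} \leq a_3 \leq -\frac{4}{25}a_1^3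 + \frac35 a_1a_2 + qa_1 + \frac{1}{50}(4a_1^2 + 50q - 10a_2)^{3/2}$ (the quantity $4a_1^2+50q-10a_2$ is a non-negative real by (b)); (d) $-6\sqrt{q}\,a_2 - 20qa_1 - 50q\sqrt{q} \leq a_3 \leq 6\sqrt{q}\,a_2 - 20qa_1 + 50q\sqrt{q}$. If $h(x) \in W_q(5)$ or (a)–(d) hold, then the elements of $S$ are real numbers $\theta_1 \leq \theta_2 \leq \theta_3$. Consider further: (e) $\frac{3a_1^4}{125} - \frac{3a_1^2a_2}{25} - qa_1^2 + \frac{2a_1a_3}{5} + 3qa_2 - 5q^2 + 5\theta_1 \leq a_4 \leq \frac{3a_1^4}{125} - \frac{3a_1^2a_2}{25} - qa_1^2 + \frac{2a_1a_3}{5} + 3qa_2 - 5q^2 + 5\theta_2$; (f) $4\sqrt{q}\,|4qa_1 + a_3| - 9qa_2 - 25q^2 \leq a_4$; (g) $-2\sqrt{q}\,a_4 - 2qa_3 - 2q\sqrt{q}\,a_2 - 2q^2a_1 - 2q^2\sqrt{q} \leq a_5 \leq 2\sqrt{q}\,a_4 - 2qa_3 + 2q\sqrt{q}\,a_2 - 2q^2a_1 + 2q^2\sqrt{q}$. If $u_3 = 0$, for $i_1,i_2 \in \{+1,-1\}$ set $x_{i_1,i_2} = i_1\sqrt{-u_2 + i_2\sqrt{u_2^2 - u_4}}$. If $u_3 \neq 0$, set $v_2 = -\frac{u_2^2}{3} - u_4$, $v_3 = \frac{2u_2u_4}{3} - \frac{2u_2^3}{27} - 2u_3^2$, let $C$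 be a complex third root of $-v_3$ if $v_2 = 0$ and of $\frac12\left(-v_3 + \sqrt{v_3^2 + \frac{4}{27}v_2^3}\right)$ if $v_2 \neq 0$, let $y = C - \frac{v_2}{3C} - \frac{2u_2}{3}$, and set $x_{i_1,i_2} = \frac{i_1\sqrt{2y} + i_2\sqrt{-4u_2 - 2y - i_1\frac{8u_3}{\sqrt{2y}}}}{2}$. If $h(x) \in W_q(5)$ or (a)–(f) hold, then the four elements $x_{i_1,i_2}$ are real numbers $\gamma_1 \leq \gamma_2 \leq \gamma_3 \leq \gamma_4$; using them define $\Lambda_1 = \max\{H(\gamma_1),H(\gamma_3)\}$ and $\Lambda_2 = \min\{H(\gamma_2),H(\gamma_4)\}$, where $H(x) = -x^5 - \frac{10}{3}u_2x^3 - 10u_3x^2 - 5u_4x$, and let $A = -\frac{4a_1^5}{3125} + \frac{a_1^3(a_2 + 15q)}{125} - \frac{a_1^2a_3}{25} - \frac{a_1(3a_2q - a_4 + 5q^2)}{5} + 2qa_3$. Consider finally (h) $\Lambda_1 + A \leq a_5 \leq \Lambda_2 + A$. Then $h(x) \in W_q(5)$ if and only if (a)–(h) all hold. Moreover, $h(x) \in W_q(5)$ has a real root if and only if at least one of the inequalities in (a), (b* ), (d), (f) or (g) is an equality. Explicitly, $h(x)$ lies in $W_q(5)$ and has a real root if and only if exactly one of the following (mutually exclusive) cases occurs: (I) $q$ is a square and $h(x) = (x+\sqrt{q})^2h_0(x)$ or $h(x) = (x-\sqrt{q})^2h_0(x)$ with $h_0(x) \in W_q(4)$; (II) $q$ is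 not a square and $h(x) = (x^2-q)^2h_0(x)$ with $h_0(x) \in W_q(3)$.
   Context: A $q$-Weil polynomial is a monic polynomial in $\mathbb{Z}[x]$ of even positive degree $2g$ whose set of complex roots has the form $\{w_1,\bar w_1,\ldots,w_g,\bar w_g\}$ with $|w_i| = \sqrt{q}$ for every $i$. $W_q(g)$ denotes the set of $q$-Weil polynomials of degree $2g$. For a positive real $r$, $r^{1/n}$ and $\sqrt[n]{r}$ denote the positive real $n$-th root; in all other cases these symbols denote an arbitrary complex $n$-th root. *)

theory Defs
  imports "HOL-Analysis.Analysis" "HOL-Computational_Algebra.Computational_Algebra"
begin

definition prime_power :: "nat \<Rightarrow> bool" where
  "prime_power q \<longleftrightarrow> (\<exists>p k. prime p \<and> k \<ge> 1 \<and> q = p ^ k)"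

definition weil_poly :: "nat \<Rightarrow> nat \<Rightarrow> int poly \<Rightarrow> bool" where
  "weil_poly q g h \<longleftrightarrow> g > 0 \<and> lead_coeff h = 1 \<and> degree h = 2 * g \<and>
     (\<exists>w :: nat \<Rightarrow> complex. (\<forall>i<g. cmod (w i) = sqrt (real q)) \<and>
        map_poly of_int h = (\<Prod>i<g. [:- w i, 1:] * [:- cnj (w i), 1:]))"

definition hpoly :: "nat \<Rightarrow> int \<Rightarrow> int \<Rightarrow> int \<Rightarrow> int \<Rightarrow> int \<Rightarrow> int poly" where
  "hpoly q a1 a2 a3 a4 a5 =
     [: int q ^ 5, a1 * int q ^ 4, a2 * int q ^ 3, a3 * int q ^ 2, a4 * int q, a5,
        a4, a3, a2, a1, 1 :]"

text \<open>Convention for the square-root symbol: for a positive real r it denotes the positive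
  real root, otherwise an arbitrary complex square root.\<close>
definition is_sqrt :: "complex \<Rightarrow> complex \<Rightarrow> bool" where
  "is_sqrt r z \<longleftrightarrow> z ^ 2 = r \<and> (r \<in> \<real> \<and> Re r > 0 \<longrightarrow> z = complex_of_real (sqrt (Re r)))"

end

theory Submission
  imports Defs
begin

text \<open>
  Write \<open>h(x) = x^5 f(x + q/x)\<close>. Then \<open>h\<close> is a Weil polynomial iff \<open>f\<close> has five real roots, all of
  them in \<open>[-2 sqrt q, 2 sqrt q]\<close>. For a real-rooted \<open>f\<close> the roots lie in this interval iff the Taylor
  coefficients of \<open>f\<close> at \<open>2 sqrt q\<close> are nonnegative and those at \<open>-2 sqrt q\<close> alternate in sign: these
  are (a), (b*), (d), (f) and (g), and a root is an end point iff one of them is an equality.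
  Real-rootedness is climbed up the derivatives of the depressed quintic: if \<open>p'\<close> is real-rooted, then
  \<open>p\<close> is real-rooted iff its values at the sorted roots of \<open>p'\<close> alternate in sign. The second
  derivative is the cubic \<open>x^3 + u2 x + u3\<close>, up to a factor, whose discriminant yields (b) and (c); its
  roots, given by Cardano's formula, yield (e); and the roots of the first derivative, given by
  Ferrari's formula, yield (h).
\<close>

section \<open>Real-rooted polynomials\<close>

text \<open>Repeated roots are allowed and the equality cases belong to the theorem, so the
  alternation criterion must hold with weak inequalities. Roots are therefore counted with
  multiplicity: one direction rests on Laguerre's inequality, the other on comparing root orders of
  a polynomial and its derivative. The scaling of \<open>u2\<close>, \<open>u3\<close>,
  \<open>u4\<close> comes from the shift of \<open>f\<close> by \<open>a1 / 5\<close>, which gives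
  \<open>F = x^5 + 10/3 u2 x^3 + 10 u3 x^2 + 5 u4 x + (a5 - A)\<close>. Then \<open>F' = 5 P\<close>
  with \<open>P = x^4 + 2 u2 x^2 + 4 u3 x + u4\<close>, and \<open>P' = 4 (x^3 + u2 x + u3)\<close>.
  At each level the constant term is the only coefficient that the derivative does not see, so
  alternation at the critical points confines it to an interval: \<open>u4\<close> in (e),
  \<open>a5 - A\<close> in (h). The end points of each interval make sense only when the level below
  is real-rooted. Hence reality of the radical expressions is proved level by level: they are first
  shown to be all roots over the complex numbers, by polynomial identities. For the cubic, reality
  comes from conjugation symmetry; for the quartic, from real-rootedness.\<close>

definition real_rooted :: "real poly \<Rightarrow> bool" where
  "real_rooted p \<longleftrightarrow> p \<noteq> 0 \<and> size (proots p) = degree p"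

lemma prod_mset_proots_dvd:
  fixes p :: "'a::idom poly"
  assumes "p \<noteq> 0"
  shows "(\<Prod>x\<in>#proots p. [:-x, 1:]) dvd p"
  using assms
proof (induction "degree p" arbitrary: p rule: less_induct)
  case less
  show ?case
  proof (cases "\<exists>x. poly p x = 0")
    case False
    then have "set_mset (proots p) = {}"
      using less.prems by (subst set_count_proots) auto
    then show ?thesis by simp
  next
    case True
    then obtain x where "poly p x = 0" by blast
    then obtain q where q: "p = [:-x, 1:] * q"
      unfolding poly_eq_0_iff_dvd by blast
    with less.prems have "q \<noteq> 0" by auto
    then have "proots p = add_mset x (proots q)" "degree p = Suc (degree q)"
      unfolding q by (simp_all add: proots_mult degree_mult_eq del: mult_pCons_left)
    moreover from this less.hyps[of q] \<open>q \<noteq> 0\<close>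
    have "(\<Prod>x\<in>#proots q. [:-x, 1:]) dvd q" by simp
    then have "[:-x, 1:] * (\<Prod>x\<in>#proots q. [:-x, 1:]) dvd [:-x, 1:] * q"
      by (intro mult_dvd_mono dvd_refl)
    ultimately show ?thesis
      unfolding q by (simp del: mult_pCons_left)
  qed
qed

lemma prod_linear_factors:
  fixes r :: "nat \<Rightarrow> 'a::idom"
  shows "(\<Prod>i<n. [:- r i, 1:]) \<noteq> 0" "degree (\<Prod>i<n. [:- r i, 1:]) = n"
    "lead_coeff (\<Prod>i<n. [:- r i, 1:]) = 1"
    "proots (\<Prod>i<n. [:- r i, 1:]) = image_mset r (mset_set {..<n})"
proof -
  show "(\<Prod>i<n. [:- r i, 1:]) \<noteq> 0" by simp
  show "degree (\<Prod>i<n. [:- r i, 1:]) = n" by (subst degree_prod_sum_eq) auto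
  show "lead_coeff (\<Prod>i<n. [:- r i, 1:]) = 1" by (simp add: lead_coeff_prod)
  show "proots (\<Prod>i<n. [:- r i, 1:]) = image_mset r (mset_set {..<n})"
    by (subst proots_prod) (auto simp: sum_unfold_sum_mset)
qed

lemma real_rootedI:
  fixes r :: "nat \<Rightarrow> real"
  assumes "p = smult c (\<Prod>i<n. [:- r i, 1:])" "c \<noteq> 0"
  shows "real_rooted p"
  using assms prod_linear_factors[of r n] by (simp add: real_rooted_def)

lemma real_rootedE:
  assumes "real_rooted p"
  obtains r where "\<And>i j. i \<le> j \<Longrightarrow> j < degree p \<Longrightarrow> r i \<le> r j"
    "p = smult (lead_coeff p) (\<Prod>i<degree p. [:- r i, 1:])"
proof -
  define xs where "xs = sorted_list_of_multiset (proots p)"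
  have xs: "mset xs = proots p" "sorted xs" "length xs = degree p"
    using assms unfolding xs_def real_rooted_def by (auto simp flip: size_mset)
  from assms have "p \<noteq> 0" by (simp add: real_rooted_def)
  then obtain q where q: "p = (\<Prod>x\<in>#proots p. [:-x, 1:]) * q"
    using prod_mset_proots_dvd by blast
  have "(\<Prod>x\<in>#proots p. [:-x, 1:]) = (\<Prod>x\<leftarrow>xs. [:-x, 1:])"
    by (simp flip: xs(1) prod_mset_prod_list)
  also have "\<dots> = (\<Prod>i<degree p. [:- (xs ! i), 1:])"
    by (subst prod.list_conv_set_nth) (auto simp: xs(3) atLeast0LessThan)
  finally have q': "p = (\<Prod>i<degree p. [:- (xs ! i), 1:]) * q" using q by simp
  define L where "L = (\<Prod>i<degree p. [:- (xs ! i), 1:])"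
  have L: "L \<noteq> 0" "degree L = degree p" "lead_coeff L = 1"
    unfolding L_def by (rule prod_linear_factors)+
  have pL: "p = L * q" using q' unfolding L_def .
  with \<open>p \<noteq> 0\<close> have "q \<noteq> 0" by auto
  have "degree (L * q) = degree L + degree q" by (rule degree_mult_eq) fact+
  with L(2) pL have "degree q = 0" by simp
  then obtain c where "q = [:c:]" by (auto elim: degree_eq_zeroE)
  with pL have p: "p = smult c L" by simp
  have lc: "lead_coeff p = c" unfolding p using L(3) by simp
  have "p = smult (lead_coeff p) L" unfolding lc by (rule p)
  with xs show ?thesis
    by (intro that[of "\<lambda>i. xs ! i"]) (auto simp: sorted_iff_nth_mono L_def)
qed

text \<open>Generic in \<open>f\<close> because it serves both the embedding of the integers and
  that of the reals.\<close>

lemma map_poly_mult_hom: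
  fixes f :: "'a::comm_semiring_0 \<Rightarrow> 'b::comm_semiring_0"
  assumes f: "f 0 = 0" "\<And>x y. f (x + y) = f x + f y" "\<And>x y. f (x * y) = f x * f y"
  shows "map_poly f (p * q) = map_poly f p * map_poly f q"
proof (rule poly_eqI)
  fix n
  have "coeff (map_poly f (p * q)) n = f (\<Sum>i\<le>n. coeff p i * coeff q (n - i))"
    by (simp add: coeff_map_poly f(1) coeff_mult)
  also have "\<dots> = (\<Sum>i\<le>n. f (coeff p i * coeff q (n - i)))"
    using sum_comp_morphism[OF f(1,2), of "\<lambda>i. coeff p i * coeff q (n - i)"] by (simp add: o_def)
  finally show "coeff (map_poly f (p * q)) n = coeff (map_poly f p * map_poly f q) n"
    by (simp add: coeff_map_poly f coeff_mult)
qed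

lemma map_poly_prod_hom:
  fixes f :: "'a::comm_semiring_1 \<Rightarrow> 'b::comm_semiring_1"
  assumes f: "f 0 = 0" "f 1 = 1" "\<And>x y. f (x + y) = f x + f y" "\<And>x y. f (x * y) = f x * f y"
  shows "map_poly f (\<Prod>i\<in>A. g i) = (\<Prod>i\<in>A. map_poly f (g i))"
  by (induction A rule: infinite_finite_induct) (simp_all add: f map_poly_mult_hom)

lemma map_poly_of_real_factors:
  "map_poly complex_of_real (smult c (\<Prod>i<n. [:- r i, 1:])) =
    smult (of_real c) (\<Prod>i<n. [:- of_real (r i), 1:])"
  by (simp add: map_poly_smult map_poly_prod_hom map_poly_pCons)

lemma map_poly_of_real_eq_iff:
  "map_poly complex_of_real p = map_poly complex_of_real q \<longleftrightarrow> p = q"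
  by (simp add: poly_eq_iff coeff_map_poly)

text \<open>By the fundamental theorem of algebra the complex factorization always exists, so only
  the reality of its roots is at stake. This makes real-rootedness testable one complex zero at a
  time.\<close>

lemma real_rooted_iff_complex_roots:
  assumes "p \<noteq> 0"
  shows "real_rooted p \<longleftrightarrow> (\<forall>z. poly (map_poly complex_of_real p) z = 0 \<longrightarrow> z \<in> \<real>)"
proof
  assume "real_rooted p"
  then obtain r where r: "p = smult (lead_coeff p) (\<Prod>i<degree p. [:- r i, 1:])"
    using real_rootedE by blast
  define c n where "c = lead_coeff p" and "n = degree p"
  have p: "p = smult c (\<Prod>i<n. [:- r i, 1:])"
    unfolding c_def n_def by (rule r)
  have "c \<noteq> 0" using assms by (simp add: c_def)
  then show "\<forall>z. poly (map_poly complex_of_real p) z = 0 \<longrightarrow> z \<in> \<real>"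
    unfolding p map_poly_of_real_factors by (auto simp: poly_prod)
next
  assume real: "\<forall>z. poly (map_poly complex_of_real p) z = 0 \<longrightarrow> z \<in> \<real>"
  define P where "P = map_poly complex_of_real p"
  obtain root where root: "smult (lead_coeff P) (\<Prod>i<degree P. [:-root i, 1:]) = P"
    using complex_poly_decompose' by blast
  have root_real: "root i = of_real (Re (root i))" if "i < degree P" for i
  proof -
    have "poly P (root i) = 0"
      by (subst root[symmetric]) (use that in \<open>auto simp: poly_prod\<close>)
    then show ?thesis using real by (simp add: P_def)
  qed
  have lc: "lead_coeff P = of_real (lead_coeff p)"
    by (simp add: P_def coeff_map_poly degree_map_poly)
  have "map_poly complex_of_real p = smult (lead_coeff P) (\<Prod>i<degree P. [:- root i, 1:])"
    unfolding root by (simp add: P_def)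
  also have "(\<Prod>i<degree P. [:- root i, 1:]) = (\<Prod>i<degree P. [:- of_real (Re (root i)), 1:])"
    using root_real by (intro prod.cong) auto
  finally have "map_poly complex_of_real p =
      map_poly of_real (smult (lead_coeff p) (\<Prod>i<degree P. [:- Re (root i), 1:]))"
    unfolding lc map_poly_of_real_factors .
  then have "p = smult (lead_coeff p) (\<Prod>i<degree P. [:- Re (root i), 1:])"
    unfolding map_poly_of_real_eq_iff .
  then show "real_rooted p"
    by (rule real_rootedI) (use assms in simp)
qed

text \<open>For non-real \<open>z\<close> all terms of \<open>p' z / p z = (\<Sum>i. 1 / (z - r i))\<close> have imaginary parts
  of the same sign, as in the Gauss--Lucas theorem.\<close>
lemma real_rooted_pderiv:
  assumes "real_rooted p" "degree p \<noteq> 0"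
  shows "real_rooted (pderiv p)"
proof -
  have p'0: "pderiv p \<noteq> 0" using assms(2) by (simp add: pderiv_eq_0_iff)
  obtain r where r: "p = smult (lead_coeff p) (\<Prod>i<degree p. [:- r i, 1:])"
    using assms(1) real_rootedE by blast
  define c n where "c = complex_of_real (lead_coeff p)" and "n = degree p"
  have "c \<noteq> 0" "n > 0" using assms by (auto simp: c_def n_def)
  have "map_poly complex_of_real p = smult c (\<Prod>i<n. [:- of_real (r i), 1:])"
    unfolding c_def n_def by (subst r) (rule map_poly_of_real_factors)
  moreover have "map_poly complex_of_real (pderiv p) = pderiv (map_poly complex_of_real p)"
    by (rule poly_eqI) (simp add: coeff_map_poly coeff_pderiv)
  ultimately have p': "map_poly complex_of_real (pderiv p) =
      smult c (\<Sum>i<n. \<Prod>j\<in>{..<n}-{i}. [:- of_real (r j), 1:])"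
    by (simp add: pderiv_smult pderiv_prod pderiv_pCons)
  have "z \<in> \<real>" if z: "poly (map_poly complex_of_real (pderiv p)) z = 0" for z
  proof (rule ccontr)
    assume nreal: "z \<notin> \<real>"
    then have Im: "Im z \<noteq> 0" by (auto simp: complex_is_Real_iff)
    have nz: "z - of_real (r j) \<noteq> 0" for j using nreal by auto
    have "(\<Sum>i<n. \<Prod>j\<in>{..<n}-{i}. (z - of_real (r j))) =
        (\<Sum>i<n. (\<Prod>j<n. z - of_real (r j)) * inverse (z - of_real (r i)))"
      using nz by (intro sum.cong refl) (simp add: prod.remove field_simps)
    then have "(\<Sum>i<n. inverse (z - of_real (r i))) = 0"
      using z \<open>c \<noteq> 0\<close> nz unfolding p'
      by (simp add: poly_sum poly_prod sum_distrib_left[symmetric])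
    then have "Im (\<Sum>i<n. inverse (z - of_real (r i))) = 0" by simp
    then have "Im z * (\<Sum>i<n. 1 / ((Re z - r i)\<^sup>2 + (Im z)\<^sup>2)) = 0"
      by (simp add: sum_distrib_left sum_negf)
    then have "(\<Sum>i<n. 1 / ((Re z - r i)\<^sup>2 + (Im z)\<^sup>2)) = 0" using Im by simp
    moreover have "(\<Sum>i<n. 1 / ((Re z - r i)\<^sup>2 + (Im z)\<^sup>2)) > 0"
      using Im \<open>n > 0\<close> by (intro sum_pos) (auto intro!: divide_pos_pos add_nonneg_pos)
    ultimately show False by simp
  qed
  then show ?thesis using real_rooted_iff_complex_roots[OF p'0] by blast
qed

text \<open>Multiplying \<open>p\<close> by \<open>x - r\<close> turns \<open>p'^2 - p p''\<close>
  into \<open>(p'^2 - p p'') (x - r)^2 + p^2\<close>. Nonnegativity is inherited, and the last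
  square gives strictness away from the roots. Both versions are carried along because the empty
  product satisfies only the weak one.\<close>

lemma laguerre_factors:
  fixes r :: "nat \<Rightarrow> real"
  defines "P \<equiv> \<lambda>n. \<Prod>i<n. [:- r i, 1:]"
  shows "(poly (pderiv (P n)) x)\<^sup>2 - poly (P n) x * poly (pderiv (pderiv (P n))) x \<ge> 0 \<and>
    (n > 0 \<and> poly (P n) x \<noteq> 0 \<longrightarrow>
      (poly (pderiv (P n)) x)\<^sup>2 - poly (P n) x * poly (pderiv (pderiv (P n))) x > 0)"
proof (induction n)
  case 0
  then show ?case by (simp add: P_def)
next
  case (Suc n)
  define a b c where "a = poly (P n) x" and "b = poly (pderiv (P n)) x"
    and "c = poly (pderiv (pderiv (P n))) x"
  have P: "P (Suc n) = P n * [:- r n, 1:]" by (simp add: P_def del: mult_pCons_right)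
  have eqs: "poly (P (Suc n)) x = a * (x - r n)" "poly (pderiv (P (Suc n))) x = a + b * (x - r n)"
    "poly (pderiv (pderiv (P (Suc n)))) x = 2 * b + c * (x - r n)"
    unfolding P pderiv_mult pderiv_add a_def b_def c_def
    by (simp_all add: pderiv_pCons pderiv_mult pderiv_add algebra_simps)
  have "(poly (pderiv (P (Suc n))) x)\<^sup>2 - poly (P (Suc n)) x * poly (pderiv (pderiv (P (Suc n)))) x =
      (b\<^sup>2 - a * c) * (x - r n)\<^sup>2 + a\<^sup>2"
    unfolding eqs by (simp add: power2_eq_square algebra_simps)
  moreover have "b\<^sup>2 - a * c \<ge> 0" using Suc unfolding a_def b_def c_def by simp
  moreover have "a \<noteq> 0" if "poly (P (Suc n)) x \<noteq> 0" using that by (simp add: P a_def)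
  ultimately show ?case
    by (auto intro: add_nonneg_pos)
qed

lemma laguerre_strict:
  assumes "real_rooted p" "degree p \<noteq> 0" "poly p x \<noteq> 0"
  shows "poly p x * poly (pderiv (pderiv p)) x < (poly (pderiv p) x)\<^sup>2"
proof -
  obtain r where r: "p = smult (lead_coeff p) (\<Prod>i<degree p. [:- r i, 1:])"
    using assms(1) real_rootedE by blast
  define c n where "c = lead_coeff p" and "n = degree p"
  define P where "P = (\<Prod>i<n. [:- r i, 1:])"
  have p: "p = smult c P"
    unfolding c_def n_def P_def by (rule r)
  have "n > 0" using assms(2) by (simp add: n_def)
  moreover have "c \<noteq> 0" "poly P x \<noteq> 0" using assms(3) unfolding p by auto
  ultimately have "c\<^sup>2 * ((poly (pderiv P) x)\<^sup>2 - poly P x * poly (pderiv (pderiv P)) x) > 0"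
    using laguerre_factors[where n=n and x=x and r=r] unfolding P_def by simp
  then show ?thesis by (simp add: p pderiv_smult power2_eq_square algebra_simps)
qed

text \<open>At a critical point that is not a root, Laguerre's inequality forces \<open>p\<close> and \<open>p''\<close> to have
  opposite signs, and the sign of \<open>p''\<close> is read off from the factorisation of \<open>p'\<close>.\<close>
lemma alternating_values_if_real_rooted:
  fixes g :: "nat \<Rightarrow> real"
  assumes p': "pderiv p = smult c (\<Prod>i<n. [:- g i, 1:])" and "c > 0"
    and mono: "\<And>i j. i \<le> j \<Longrightarrow> j < n \<Longrightarrow> g i \<le> g j"
    and rr: "real_rooted p" and "i < n"
  shows "(-1) ^ (n - i) * poly p (g i) \<ge> 0"
proof (cases "poly p (g i) = 0")
  case False
  have "degree p \<noteq> 0"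
    using p' \<open>c > 0\<close> prod_linear_factors(1)[of g n]
    by (metis less_irrefl pderiv_eq_0_iff smult_eq_0_iff)
  moreover have "poly (pderiv p) (g i) = 0"
    using \<open>i < n\<close> by (auto simp: p' poly_prod)
  ultimately have neg: "poly p (g i) * poly (pderiv (pderiv p)) (g i) < 0"
    using laguerre_strict[OF rr _ False] by simp
  define e :: real where "e = (-1) ^ (n - Suc i)"
  \<comment> \<open>At \<open>g i\<close> every summand with \<open>k\<close> different from
    \<open>i\<close> contains the factor \<open>g i - g i\<close>.\<close>
  have "(\<Sum>k<n. \<Prod>j\<in>{..<n}-{k}. g i - g j) = (\<Prod>j\<in>{..<n}-{i}. g i - g j)"
  proof -
    have "(\<Prod>j\<in>{..<n}-{k}. g i - g j) = 0" if "k < n" "k \<noteq> i" for k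
      using that \<open>i < n\<close> by (intro prod_zero) auto
    then have "(\<Sum>k\<in>{..<n}-{i}. \<Prod>j\<in>{..<n}-{k}. g i - g j) = 0"
      by (intro sum.neutral) auto
    then show ?thesis using \<open>i < n\<close> by (subst sum.remove[of _ i]) auto
  qed
  then have "poly (pderiv (pderiv p)) (g i) = c * (\<Prod>j\<in>{..<n}-{i}. g i - g j)"
    by (simp add: p' pderiv_smult pderiv_prod pderiv_pCons poly_sum poly_prod)
  also have "{..<n}-{i} = {..<i} \<union> {Suc i..<n}" using \<open>i < n\<close> by auto
  also have "(\<Prod>j\<in>{..<i} \<union> {Suc i..<n}. g i - g j) =
      (\<Prod>j<i. g i - g j) * (\<Prod>j\<in>{Suc i..<n}. (-1) * (g j - g i))"
    by (subst prod.union_disjoint) auto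
  also have "\<dots> = (\<Prod>j<i. g i - g j) * (e * (\<Prod>j\<in>{Suc i..<n}. g j - g i))"
    unfolding prod.distrib e_def by simp
  finally have "e * poly (pderiv (pderiv p)) (g i) =
      c * (\<Prod>j<i. g i - g j) * (\<Prod>j\<in>{Suc i..<n}. g j - g i) * (e * e)"
    by simp
  also have "e * e = 1" by (simp add: e_def flip: power_add mult_2)
  finally have "e * poly (pderiv (pderiv p)) (g i) =
      c * (\<Prod>j<i. g i - g j) * (\<Prod>j\<in>{Suc i..<n}. g j - g i)" by simp
  moreover have "(\<Prod>j<i. g i - g j) \<ge> 0" "(\<Prod>j\<in>{Suc i..<n}. g j - g i) \<ge> 0"
    using mono \<open>i < n\<close> by (auto intro!: prod_nonneg)
  ultimately have "e * poly (pderiv (pderiv p)) (g i) \<ge> 0" using \<open>c > 0\<close> by simp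
  \<comment> \<open>The exponent is one larger than in \<open>e\<close>: \<open>e\<close> is the
    sign of the \<open>n - Suc i\<close> factors to the right of \<open>i\<close>, and the extra
    sign reflects that \<open>p\<close> and \<open>p''\<close> have opposite signs.\<close>
  moreover have "(-1) ^ (n - i) = - e"
    using \<open>i < n\<close> unfolding e_def by (simp add: Suc_diff_Suc[symmetric])
  moreover have "e = 1 \<or> e = -1"
    unfolding e_def by (cases "even (n - Suc i)") auto
  ultimately show ?thesis using neg
    by (auto simp: mult_less_0_iff zero_le_mult_iff)
qed simp

text \<open>The reflected polynomial \<open>(-1)^n p(-x)\<close>, with \<open>n\<close> the degree,
  has the same leading coefficient, so the behaviour at plus infinity applies to it.\<close>

lemma poly_sign_far_left:
  fixes p :: "real poly"
  assumes "lead_coeff p > 0"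
  shows "\<exists>x\<le>b. (-1) ^ degree p * poly p x > 0"
proof -
  define q where "q = smult ((-1) ^ degree p) (pcompose p [:0, -1:])"
  have "lead_coeff q = lead_coeff p"
    by (simp add: q_def lead_coeff_comp flip: power_mult_distrib)
  with assms obtain m where m: "\<forall>x\<ge>m. lead_coeff q \<le> poly q x"
    using poly_pinfty_gt_lc[of q] by auto
  define x where "x = max m (- b)"
  have "poly q x > 0" using m assms \<open>lead_coeff q = lead_coeff p\<close>
    by (smt (verit) max.cobounded1 x_def)
  then show ?thesis
    by (intro exI[of _ "-x"]) (auto simp: q_def poly_pcompose x_def)
qed

lemma alternating_signs_product:
  fixes u v :: real
  assumes "(-1) ^ Suc k * u \<ge> 0" "(-1) ^ k * v \<ge> 0"
  shows "u * v \<le> 0"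
  using assms by (cases "even k") (auto simp: mult_le_0_iff)

lemma poly_root_between:
  fixes p :: "real poly"
  assumes "a \<le> b" "poly p a * poly p b \<le> 0"
  shows "\<exists>x. a \<le> x \<and> x \<le> b \<and> poly p x = 0"
proof -
  have "poly p a \<le> 0 \<and> 0 \<le> poly p b \<or> poly p b \<le> 0 \<and> 0 \<le> poly p a"
    using assms(2) by (auto simp: mult_le_0_iff)
  then show ?thesis
    using IVT[of "poly p" a 0 b] IVT2[of "poly p" b 0 a] assms(1) by auto
qed

text \<open>The \<open>n\<close> critical points cut the line into \<open>n + 1\<close> slots, and
  each slot sees a weak sign change; the two unbounded slots use the sign of \<open>p\<close> near
  infinity. Adjacent slots share an end point, so the roots found need not be distinct.\<close>

lemma interlacing_roots_exist:
  fixes g :: "nat \<Rightarrow> real"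
  assumes lc: "lead_coeff p > 0" and deg: "degree p = Suc n" and "n > 0"
    and mono: "\<And>i j. i \<le> j \<Longrightarrow> j < n \<Longrightarrow> g i \<le> g j"
    and alt: "\<And>i. i < n \<Longrightarrow> (-1) ^ (n - i) * poly p (g i) \<ge> 0"
    and "i \<le> n"
  shows "\<exists>r. poly p r = 0 \<and> (i < n \<longrightarrow> r \<le> g i) \<and> (i > 0 \<longrightarrow> g (i - 1) \<le> r)"
proof -
  consider "i = 0" | "i = n" | "0 < i" "i < n" using \<open>i \<le> n\<close> by linarith
  then show ?thesis
  proof cases
    case 1
    obtain x where x: "x \<le> g 0" "(-1) ^ Suc n * poly p x > 0"
      using poly_sign_far_left[OF lc, of "g 0"] deg by auto
    have "poly p x * poly p (g 0) \<le> 0"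
      using x(2) alt[of 0] \<open>n > 0\<close> by (intro alternating_signs_product[of n]) auto
    then show ?thesis using poly_root_between[OF x(1), of p] 1 by auto
  next
    case 2
    obtain m where m: "\<forall>x\<ge>m. lead_coeff p \<le> poly p x"
      using poly_pinfty_gt_lc[OF lc] by auto
    define x where "x = max m (g (n - 1))"
    have "poly p x > 0" using m lc by (smt (verit) max.cobounded1 x_def)
    moreover have "poly p (g (n - 1)) \<le> 0" using alt[of "n - 1"] \<open>n > 0\<close> by simp
    ultimately have "poly p (g (n - 1)) * poly p x \<le> 0" by (simp add: mult_le_0_iff)
    then show ?thesis
      using poly_root_between[of "g (n - 1)" x p] 2 by (auto simp: x_def)
  next
    case 3
    have "n - (i - 1) = Suc (n - i)" using 3 by simp
    then have "poly p (g (i - 1)) * poly p (g i) \<le> 0"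
      using 3 alt[of "i - 1"] alt[of i] by (intro alternating_signs_product[of "n - i"]) auto
    then show ?thesis
      using poly_root_between[of "g (i - 1)" "g i" p] mono[of "i - 1" i] 3 by auto
  qed
qed

text \<open>A root \<open>a\<close> of \<open>p\<close> that occurs \<open>k\<close> times in the interlacing sequence of roots forces \<open>k - 1\<close>
  of the intermediate critical points to equal \<open>a\<close>, so the multiplicities add up to the degree.\<close>
lemma real_rooted_if_alternating_values:
  fixes g :: "nat \<Rightarrow> real"
  assumes p': "pderiv p = smult c (\<Prod>i<n. [:- g i, 1:])" and "c > 0" and "n > 0"
    and mono: "\<And>i j. i \<le> j \<Longrightarrow> j < n \<Longrightarrow> g i \<le> g j"
    and alt: "\<And>i. i < n \<Longrightarrow> (-1) ^ (n - i) * poly p (g i) \<ge> 0"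
  shows "real_rooted p"
proof -
  have "degree (pderiv p) = n" "lead_coeff (pderiv p) = c" "pderiv p \<noteq> 0"
    using \<open>c > 0\<close> prod_linear_factors[of g n] by (simp_all add: p')
  then have deg: "degree p = Suc n" using \<open>n > 0\<close> by (simp add: degree_pderiv)
  have "c = real (Suc n) * lead_coeff p"
    using \<open>lead_coeff (pderiv p) = c\<close> \<open>degree (pderiv p) = n\<close> by (simp add: coeff_pderiv deg)
  with \<open>c > 0\<close> have lc: "lead_coeff p > 0" by (simp add: zero_less_mult_iff)
  then have "p \<noteq> 0" by auto
  obtain r where r: "\<And>i. i \<le> n \<Longrightarrow> poly p (r i) = 0"
    "\<And>i. i < n \<Longrightarrow> r i \<le> g i" "\<And>i. i < n \<Longrightarrow> g i \<le> r (Suc i)"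
  proof -
    have "\<forall>i. \<exists>r. i \<le> n \<longrightarrow> poly p r = 0 \<and> (i < n \<longrightarrow> r \<le> g i) \<and> (i > 0 \<longrightarrow> g (i - 1) \<le> r)"
      using interlacing_roots_exist[OF lc deg \<open>n > 0\<close> mono alt] by blast
    then obtain r where r: "\<forall>i. i \<le> n \<longrightarrow> poly p (r i) = 0 \<and> (i < n \<longrightarrow> r i \<le> g i) \<and> (i > 0 \<longrightarrow> g (i - 1) \<le> r i)"
      by metis
    moreover have "g i \<le> r (Suc i)" if "i < n" for i
      using r[rule_format, of "Suc i"] that by simp
    ultimately show ?thesis by (intro that[of r]) auto
  qed
  have r_mono: "r i \<le> r j" if "i \<le> j" "j \<le> n" for i j
    using that
  proof (induction j rule: dec_induct)
    case (step k)
    then show ?case using r(2)[of k] r(3)[of k] by simp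
  qed simp
  \<comment> \<open>Inclusion of multisets is what is needed: it says that each value among the
    \<open>r i\<close> is a root of at least the multiplicity with which it is listed.\<close>
  have "image_mset r (mset_set {..n}) \<subseteq># proots p"
  proof (rule mset_subset_eqI)
    fix a
    define S where "S = {i. i \<le> n \<and> r i = a}"
    have "finite S" by (simp add: S_def)
    have "card S \<le> order a p"
    proof (cases "S = {}")
      case False
      then have "poly p a = 0" using r(1) by (auto simp: S_def)
      then have ord: "order a p = Suc (order a (pderiv p))"
        using \<open>pderiv p \<noteq> 0\<close> \<open>p \<noteq> 0\<close> by (intro order_pderiv) (auto simp: order_root)
      \<comment> \<open>Squeeze: \<open>r i \<le> g i \<le> r (Suc i) \<le> r (Max S)\<close> with
        both ends equal to \<open>a\<close>. The largest index is left out because nothing bounds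
        its successor by \<open>a\<close>.\<close>
      have "g i = a" "i < n" if "i \<in> S - {Max S}" for i
      proof -
        have "i < Max S" "Max S \<in> S" "i \<in> S"
          using that \<open>finite S\<close> False Max_ge[of S i] by (auto simp: less_le)
        then show "i < n" by (auto simp: S_def)
        then have "r i \<le> g i" "g i \<le> r (Suc i)" "r (Suc i) \<le> r (Max S)"
          using r r_mono[of "Suc i" "Max S"] \<open>i < Max S\<close> \<open>Max S \<in> S\<close> by (auto simp: S_def)
        then show "g i = a" using \<open>i \<in> S\<close> \<open>Max S \<in> S\<close> by (auto simp: S_def)
      qed
      then have "card (S - {Max S}) \<le> card {i\<in>{..<n}. g i = a}"
        by (intro card_mono) auto
      also have "\<dots> = count (image_mset g (mset_set {..<n})) a"
        by (simp add: count_image_mset' eq_commute[of a])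
      also have "\<dots> = order a (pderiv p)"
        using \<open>c > 0\<close> \<open>pderiv p \<noteq> 0\<close> by (simp add: p' order_smult flip: prod_linear_factors(4))
      finally show ?thesis using ord \<open>finite S\<close> False by (simp add: card_Diff_singleton)
    qed simp
    also have "card S = count (image_mset r (mset_set {..n})) a"
      by (simp add: S_def count_image_mset' eq_commute[of a])
    finally show "count (image_mset r (mset_set {..n})) a \<le> count (proots p) a"
      using \<open>p \<noteq> 0\<close> by simp
  qed
  from size_mset_mono[OF this] have "Suc n \<le> size (proots p)" by simp
  with size_proots_le[of p] show ?thesis
    unfolding real_rooted_def using deg \<open>p \<noteq> 0\<close> by simp
qed

lemma real_rooted_iff_alternating_values:
  fixes g :: "nat \<Rightarrow> real"
  assumes "pderiv p = smult c (\<Prod>i<n. [:- g i, 1:])" and "c > 0" and "n > 0"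
    and "\<And>i j. i \<le> j \<Longrightarrow> j < n \<Longrightarrow> g i \<le> g j"
  shows "real_rooted p \<longleftrightarrow> (\<forall>i<n. (-1) ^ (n - i) * poly p (g i) \<ge> 0)"
  using alternating_values_if_real_rooted[OF assms(1,2,4)]
    real_rooted_if_alternating_values[OF assms] by blast

section \<open>Weil polynomials and their trace polynomials\<close>

text \<open>Evaluations involving \<open>x + q / x\<close> are available only for nonzero
  \<open>x\<close> and reach only part of the line; a half-line of arguments still determines a
  polynomial.\<close>

lemma poly_eq_if_eq_on_Ici:
  fixes p q :: "real poly"
  assumes "\<And>x. x \<ge> b \<Longrightarrow> poly p x = poly q x"
  shows "p = q"
proof (rule ccontr)
  assume "p \<noteq> q"
  then have "finite {x. poly (p - q) x = 0}" by (intro poly_roots_finite) simp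
  moreover have "{b..} \<subseteq> {x. poly (p - q) x = 0}" using assms by auto
  ultimately show False using infinite_Ici finite_subset by blast
qed

lemma conj_pair_factor:
  "[:- w, 1:] * [:- cnj w, 1:] = map_poly complex_of_real [:(cmod w)\<^sup>2, - (2 * Re w), 1:]"
proof -
  have "[:- w, 1:] * [:- cnj w, 1:] = [:w * cnj w, - (w + cnj w), 1:]" by simp
  also have "\<dots> = map_poly complex_of_real [:(cmod w)\<^sup>2, - (2 * Re w), 1:]"
    unfolding complex_norm_square[symmetric] complex_add_cnj by (simp add: map_poly_pCons)
  finally show ?thesis .
qed

lemma map_poly_of_int_complex:
  "(map_poly of_int h :: complex poly) = map_poly complex_of_real (map_poly real_of_int h)"
  by (simp add: map_poly_map_poly o_def)

text \<open>Here \<open>c i = w i + cnj (w i) = 2 * Re (w i)\<close>. The bound on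
  \<open>c i\<close> says exactly that \<open>x^2 - c i x + q\<close> has a conjugate pair of roots
  of modulus \<open>sqrt q\<close>, possibly a double real one.\<close>

lemma weil_poly_iff_real_factors:
  "weil_poly q g h \<longleftrightarrow> g > 0 \<and> (\<exists>c. (\<forall>i<g. \<bar>c i\<bar> \<le> 2 * sqrt (real q)) \<and>
    map_poly real_of_int h = (\<Prod>i<g. [:real q, - c i, 1:]))"
proof (intro iffI conjI; (elim conjE)?)
  assume weil: "weil_poly q g h"
  then show "g > 0" by (simp add: weil_poly_def)
  from weil obtain w where w: "\<And>i. i < g \<Longrightarrow> cmod (w i) = sqrt (real q)"
    "map_poly of_int h = (\<Prod>i<g. [:- w i, 1:] * [:- cnj (w i), 1:])"
    unfolding weil_poly_def by blast
  have "map_poly complex_of_real (map_poly real_of_int h) =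
      (\<Prod>i<g. map_poly complex_of_real [:real q, - (2 * Re (w i)), 1:])"
    unfolding map_poly_of_int_complex[symmetric] w(2) conj_pair_factor
    using w(1) by (intro prod.cong) auto
  also have "\<dots> = map_poly complex_of_real (\<Prod>i<g. [:real q, - (2 * Re (w i)), 1:])"
    by (simp add: map_poly_prod_hom)
  finally have "map_poly real_of_int h = (\<Prod>i<g. [:real q, - (2 * Re (w i)), 1:])"
    unfolding map_poly_of_real_eq_iff .
  moreover have "\<bar>2 * Re (w i)\<bar> \<le> 2 * sqrt (real q)" if "i < g" for i
    using abs_Re_le_cmod[of "w i"] w(1)[OF that] by simp
  ultimately show "\<exists>c. (\<forall>i<g. \<bar>c i\<bar> \<le> 2 * sqrt (real q)) \<and>
      map_poly real_of_int h = (\<Prod>i<g. [:real q, - c i, 1:])"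
    by (intro exI[of _ "\<lambda>i. 2 * Re (w i)"]) simp
next
  assume "g > 0" "\<exists>c. (\<forall>i<g. \<bar>c i\<bar> \<le> 2 * sqrt (real q)) \<and>
    map_poly real_of_int h = (\<Prod>i<g. [:real q, - c i, 1:])"
  then obtain c where c: "\<And>i. i < g \<Longrightarrow> \<bar>c i\<bar> \<le> 2 * sqrt (real q)"
    "map_poly real_of_int h = (\<Prod>i<g. [:real q, - c i, 1:])" by blast
  \<comment> \<open>The root of \<open>x^2 - c i x + q\<close> with nonnegative imaginary
    part.\<close>
  define w where "w i = Complex (c i / 2) (sqrt (real q - (c i / 2)\<^sup>2))" for i
  have nw: "(cmod (w i))\<^sup>2 = real q" if "i < g" for i
  proof -
    have "(c i / 2)\<^sup>2 \<le> (sqrt (real q))\<^sup>2"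
      using c(1)[OF that] by (intro abs_le_square_iff[THEN iffD1]) simp
    then show ?thesis by (simp add: w_def cmod_power2)
  qed
  have "map_poly of_int h = (\<Prod>i<g. map_poly complex_of_real [:real q, - c i, 1:])"
    unfolding map_poly_of_int_complex c(2) by (simp add: map_poly_prod_hom)
  also have "\<dots> = (\<Prod>i<g. [:- w i, 1:] * [:- cnj (w i), 1:])"
    unfolding conj_pair_factor using nw by (intro prod.cong) (auto simp: w_def)
  finally have fact: "map_poly of_int h = (\<Prod>i<g. [:- w i, 1:] * [:- cnj (w i), 1:])" .
  have "degree (map_poly real_of_int h) = 2 * g"
    unfolding c(2) by (subst degree_prod_sum_eq) auto
  moreover have "lead_coeff (map_poly real_of_int h) = 1"
    unfolding c(2) by (simp add: lead_coeff_prod)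
  ultimately have "degree h = 2 * g" "lead_coeff h = 1"
    by (simp_all add: degree_map_poly coeff_map_poly)
  moreover have "cmod (w i) = sqrt (real q)" if "i < g" for i
    using nw[OF that] by (metis norm_ge_zero real_sqrt_unique)
  ultimately show "weil_poly q g h"
    unfolding weil_poly_def using \<open>g > 0\<close> fact by (intro conjI exI[of _ w]) auto
qed

text \<open>The quintic \<open>f\<close> with \<open>h(x) = x^5 f(x + q/x)\<close>.\<close>
definition trace_poly :: "nat \<Rightarrow> int \<Rightarrow> int \<Rightarrow> int \<Rightarrow> int \<Rightarrow> int \<Rightarrow> real poly" where
  "trace_poly q a1 a2 a3 a4 a5 =
    [:of_int a5 - 2 * real q * of_int a3 + 2 * (real q)\<^sup>2 * of_int a1,
      of_int a4 - 3 * real q * of_int a2 + 5 * (real q)\<^sup>2,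
      of_int a3 - 4 * real q * of_int a1, of_int a2 - 5 * real q, of_int a1, 1:]"

lemma poly_hpoly:
  fixes x :: real
  assumes "x \<noteq> 0"
  shows "poly (map_poly of_int (hpoly q a1 a2 a3 a4 a5)) x =
    x ^ 5 * poly (trace_poly q a1 a2 a3 a4 a5) (x + real q / x)"
  using assms by (simp add: hpoly_def trace_poly_def map_poly_pCons field_simps eval_nat_numeral)

text \<open>Since \<open>x^2 - c x + q = x (x + q / x - c)\<close>, both products are linked by the
  same substitution as \<open>h\<close> and \<open>f\<close>. For the direction towards
  \<open>f\<close>, \<open>x + q / x\<close> takes every value from \<open>2 sqrt q\<close>
  upwards.\<close>

lemma hpoly_factors_iff:
  assumes "q > 0"
  shows "map_poly real_of_int (hpoly q a1 a2 a3 a4 a5) = (\<Prod>i<5::nat. [:real q, - c i, 1:]) \<longleftrightarrow>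
    trace_poly q a1 a2 a3 a4 a5 = (\<Prod>i<5::nat. [:- c i, 1:])"
    (is "?h = ?hc \<longleftrightarrow> ?f = ?fc")
proof -
  have hc: "poly ?hc x = x ^ 5 * poly ?fc (x + real q / x)" if "x \<noteq> 0" for x
  proof -
    have "poly ?hc x = (\<Prod>i<5::nat. x * (x + real q / x - c i))"
      unfolding poly_prod using that by (intro prod.cong) (auto simp: field_simps)
    then show ?thesis by (simp add: poly_prod prod.distrib)
  qed
  show ?thesis
  proof
    assume eq: "?h = ?hc"
    show "?f = ?fc"
    proof (rule poly_eq_if_eq_on_Ici[of "2 * sqrt (real q)"])
      fix y assume y: "2 * sqrt (real q) \<le> y"
      \<comment> \<open>The larger root of \<open>x^2 - y x + q\<close>, so that
        \<open>x + q / x = y\<close>.\<close>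
      define x where "x = (y + sqrt (y\<^sup>2 - 4 * real q)) / 2"
      have "(2 * sqrt (real q))\<^sup>2 \<le> y\<^sup>2" using y by (intro power_mono) auto
      then have disc: "y\<^sup>2 - 4 * real q \<ge> 0" by simp
      have "y > 0" using y assms by (intro less_le_trans[OF _ y]) simp
      then have "x > 0" unfolding x_def using disc by (intro divide_pos_pos add_pos_nonneg) auto
      have "x * (y - x) = (y\<^sup>2 - (sqrt (y\<^sup>2 - 4 * real q))\<^sup>2) / 4"
        by (simp add: x_def power2_eq_square field_simps)
      also have "\<dots> = real q" using disc by simp
      finally have "y = x + real q / x" using \<open>x > 0\<close> by (simp add: field_simps)
      then show "poly ?f y = poly ?fc y"
        using poly_hpoly[of x q a1 a2 a3 a4 a5] hc[of x] eq \<open>x > 0\<close> by simp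
    qed
  next
    assume "?f = ?fc"
    then show "?h = ?hc"
      by (intro poly_eq_if_eq_on_Ici[of 1]) (simp add: poly_hpoly hc)
  qed
qed

lemma weil_hpoly_iff_trace_poly_factors:
  assumes "q > 0"
  shows "weil_poly q 5 (hpoly q a1 a2 a3 a4 a5) \<longleftrightarrow>
    (\<exists>c. (\<forall>i<5::nat. \<bar>c i\<bar> \<le> 2 * sqrt (real q)) \<and>
      trace_poly q a1 a2 a3 a4 a5 = (\<Prod>i<5. [:- c i, 1:]))"
  unfolding weil_poly_iff_real_factors hpoly_factors_iff[OF assms] by simp

text \<open>The bound on \<open>c\<close> makes the discriminant \<open>c^2 - 4 Q\<close>
  nonpositive, so a real root forces it to vanish and is a double root.\<close>

lemma real_root_quadratic_iff:
  fixes c Q :: real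
  assumes "Q > 0" "\<bar>c\<bar> \<le> 2 * sqrt Q"
  shows "Q - c * z + z\<^sup>2 = 0 \<longleftrightarrow> (c = 2 * sqrt Q \<and> z = sqrt Q \<or> c = - 2 * sqrt Q \<and> z = - sqrt Q)"
proof
  have sq: "sqrt Q * sqrt Q = Q" using assms by simp
  have "c\<^sup>2 \<le> (2 * sqrt Q)\<^sup>2" using assms(2) by (intro abs_le_square_iff[THEN iffD1]) simp
  then have c2: "c\<^sup>2 \<le> 4 * Q" using assms(1) by simp
  assume z: "Q - c * z + z\<^sup>2 = 0"
  then have "(2 * z - c)\<^sup>2 = c\<^sup>2 - 4 * Q" by (simp add: power2_eq_square algebra_simps)
  with c2 have "(2 * z - c)\<^sup>2 = 0" by (smt (verit) zero_le_power2)
  then have "c = 2 * z" by simp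
  with z have "z\<^sup>2 = (sqrt Q)\<^sup>2" using assms(1) by (simp add: power2_eq_square)
  then show "c = 2 * sqrt Q \<and> z = sqrt Q \<or> c = - 2 * sqrt Q \<and> z = - sqrt Q"
    unfolding power2_eq_iff using \<open>c = 2 * z\<close> by auto
next
  assume "c = 2 * sqrt Q \<and> z = sqrt Q \<or> c = - 2 * sqrt Q \<and> z = - sqrt Q"
  then show "Q - c * z + z\<^sup>2 = 0" using assms(1) by (auto simp: power2_eq_square)
qed

section \<open>Locating real roots by the signs of Taylor coefficients\<close>

lemma coeff_prod_nonneg_factors:
  fixes d :: "nat \<Rightarrow> real"
  assumes "\<forall>i<n. d i \<ge> 0"
  shows "coeff (\<Prod>i<n. [:d i, 1:]) k \<ge> 0"
  using assms
proof (induction n arbitrary: k)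
  case (Suc n)
  then show ?case by (cases k) (auto simp: lessThan_Suc coeff_pCons)
qed (simp add: coeff_1)

lemma coeff_prod_pos_factors:
  fixes d :: "nat \<Rightarrow> real"
  assumes "\<forall>i<n. d i > 0" "k \<le> n"
  shows "coeff (\<Prod>i<n. [:d i, 1:]) k > 0"
  using assms
proof (induction n arbitrary: k)
  case (Suc n)
  let ?P = "\<Prod>i<n. [:d i, 1:]"
  show ?case
  proof (cases k)
    case 0
    then show ?thesis using Suc by (simp add: lessThan_Suc)
  next
    case (Suc k')
    have "coeff ?P k' > 0" using Suc Suc.prems Suc.IH by simp
    moreover have "coeff ?P (Suc k') \<ge> 0"
      using Suc.prems by (intro coeff_prod_nonneg_factors) (auto intro: less_imp_le)
    moreover from this have "d n * coeff ?P (Suc k') \<ge> 0" using Suc.prems(1) by auto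
    ultimately show ?thesis using Suc by (simp add: lessThan_Suc)
  qed
qed (simp add: coeff_1)

text \<open>If \<open>d j\<close> were negative, \<open>- d j\<close> would be a positive root; but
  a monic polynomial with nonnegative lower coefficients is positive at positive arguments.\<close>

lemma nonneg_factors_iff:
  fixes d :: "nat \<Rightarrow> real"
  shows "(\<forall>i<n. d i \<ge> 0) \<longleftrightarrow> (\<forall>k<n. coeff (\<Prod>i<n. [:d i, 1:]) k \<ge> 0)"
proof (intro iffI allI impI)
  let ?P = "\<Prod>i<n. [:d i, 1:]"
  fix j assume nonneg: "\<forall>k<n. coeff ?P k \<ge> 0" and "j < n"
  have P: "degree ?P = n" "lead_coeff ?P = 1"
    using prod_linear_factors(2,3)[where n=n and r="\<lambda>i. - d i"] by simp_all
  show "d j \<ge> 0"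
  proof (rule ccontr)
    assume neg: "\<not> d j \<ge> 0"
    have "poly ?P (- d j) = (\<Sum>k<n. coeff ?P k * (- d j) ^ k) + (- d j) ^ n"
      using P by (simp add: poly_altdef lessThan_Suc_atMost[symmetric])
    moreover have "(\<Sum>k<n. coeff ?P k * (- d j) ^ k) \<ge> 0"
      using neg nonneg by (intro sum_nonneg mult_nonneg_nonneg) auto
    moreover have "(- d j) ^ n > 0" using neg by simp
    moreover have "poly ?P (- d j) = 0"
      unfolding poly_prod using \<open>j < n\<close> by (intro prod_zero) auto
    ultimately show False by linarith
  qed
qed (use coeff_prod_nonneg_factors in blast)

text \<open>A zero among the \<open>d i\<close> kills the constant coefficient, whereas positive
  \<open>d i\<close> make all coefficients positive. This is why equality in any single condition
  already signals an extremal root.\<close>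

lemma zero_factor_iff:
  fixes d :: "nat \<Rightarrow> real"
  assumes "\<forall>i<n. d i \<ge> 0"
  shows "(\<exists>i<n. d i = 0) \<longleftrightarrow> (\<exists>k<n. coeff (\<Prod>i<n. [:d i, 1:]) k = 0)"
proof
  assume "\<exists>i<n. d i = 0"
  then obtain i where i: "i < n" "d i = 0" by blast
  then have "poly (\<Prod>i<n. [:d i, 1:]) 0 = 0"
    unfolding poly_prod by (intro prod_zero) auto
  then show "\<exists>k<n. coeff (\<Prod>i<n. [:d i, 1:]) k = 0"
    using i by (intro exI[of _ 0]) (simp add: poly_0_coeff_0)
next
  assume "\<exists>k<n. coeff (\<Prod>i<n. [:d i, 1:]) k = 0"
  then show "\<exists>i<n. d i = 0"
    using coeff_prod_pos_factors[of n d] assms by (metis less_imp_le less_irrefl order_le_less)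
qed

text \<open>\<open>T B\<close> lists the non-leading coefficients of \<open>f(x + B)\<close>, that
  is, the Taylor coefficients of \<open>f\<close> at \<open>B\<close>; the linear factors of
  \<open>f(x + B)\<close> are \<open>x + (B - c i)\<close>.\<close>

lemma coeffs_nonneg_iff_roots_le:
  fixes c :: "nat \<Rightarrow> real"
  assumes f: "[:e0, e1, e2, e3, e4, 1:] = (\<Prod>i<5::nat. [:- c i, 1:])"
  defines "T \<equiv> \<lambda>B. {e4 + 5 * B, e3 + 4 * e4 * B + 10 * B\<^sup>2,
    e2 + 3 * e3 * B + 6 * e4 * B\<^sup>2 + 10 * B ^ 3,
    e1 + 2 * e2 * B + 3 * e3 * B\<^sup>2 + 4 * e4 * B ^ 3 + 5 * B ^ 4,
    e0 + e1 * B + e2 * B\<^sup>2 + e3 * B ^ 3 + e4 * B ^ 4 + B ^ 5}"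
  shows "(\<forall>i<5. c i \<le> B) \<longleftrightarrow> (\<forall>t\<in>T B. t \<ge> 0)"
    "(\<forall>i<5. c i \<le> B) \<Longrightarrow> (\<exists>i<5. c i = B) \<longleftrightarrow> (\<exists>t\<in>T B. t = 0)"
proof -
  let ?d = "\<lambda>i. B - c i"
  define L where "L = [:e0 + e1 * B + e2 * B\<^sup>2 + e3 * B ^ 3 + e4 * B ^ 4 + B ^ 5,
      e1 + 2 * e2 * B + 3 * e3 * B\<^sup>2 + 4 * e4 * B ^ 3 + 5 * B ^ 4,
      e2 + 3 * e3 * B + 6 * e4 * B\<^sup>2 + 10 * B ^ 3,
      e3 + 4 * e4 * B + 10 * B\<^sup>2, e4 + 5 * B, 1:]"
  have "(\<Prod>i<5::nat. [:?d i, 1:]) = pcompose (\<Prod>i<5::nat. [:- c i, 1:]) [:B, 1:]"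
    by (simp add: pcompose_prod pcompose_pCons)
  also have "\<dots> = [:e0 + e1 * B + e2 * B\<^sup>2 + e3 * B ^ 3 + e4 * B ^ 4 + B ^ 5,
      e1 + 2 * e2 * B + 3 * e3 * B\<^sup>2 + 4 * e4 * B ^ 3 + 5 * B ^ 4,
      e2 + 3 * e3 * B + 6 * e4 * B\<^sup>2 + 10 * B ^ 3,
      e3 + 4 * e4 * B + 10 * B\<^sup>2, e4 + 5 * B, 1:]"
    unfolding f[symmetric]
    by (simp add: pcompose_pCons algebra_simps eval_nat_numeral)
  finally have P: "(\<Prod>i<5::nat. [:?d i, 1:]) = L" unfolding L_def .
  have co: "coeff L 0 = e0 + e1 * B + e2 * B\<^sup>2 + e3 * B ^ 3 + e4 * B ^ 4 + B ^ 5"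
    "coeff L 1 = e1 + 2 * e2 * B + 3 * e3 * B\<^sup>2 + 4 * e4 * B ^ 3 + 5 * B ^ 4"
    "coeff L 2 = e2 + 3 * e3 * B + 6 * e4 * B\<^sup>2 + 10 * B ^ 3"
    "coeff L 3 = e3 + 4 * e4 * B + 10 * B\<^sup>2" "coeff L 4 = e4 + 5 * B"
    unfolding L_def by (simp_all add: numeral_eq_Suc)
  have less5: "k < 5 \<longleftrightarrow> k = 0 \<or> k = 1 \<or> k = 2 \<or> k = 3 \<or> k = 4" for k :: nat by auto
  have all5: "(\<forall>k<5. Q k) \<longleftrightarrow> Q 0 \<and> Q 1 \<and> Q 2 \<and> Q 3 \<and> Q 4" for Q :: "nat \<Rightarrow> bool"
    unfolding less5 by blast
  have ex5: "(\<exists>k<5. Q k) \<longleftrightarrow> Q 0 \<or> Q 1 \<or> Q 2 \<or> Q 3 \<or> Q 4" for Q :: "nat \<Rightarrow> bool"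
    unfolding less5 by blast
  have "(\<forall>i<5. c i \<le> B) \<longleftrightarrow> (\<forall>i<5. ?d i \<ge> 0)" by simp
  also have "\<dots> \<longleftrightarrow> (\<forall>t\<in>T B. t \<ge> 0)"
    by (subst nonneg_factors_iff) (unfold P T_def all5 co, blast)
  finally show "(\<forall>i<5. c i \<le> B) \<longleftrightarrow> (\<forall>t\<in>T B. t \<ge> 0)" .
  assume "\<forall>i<5. c i \<le> B"
  then have "\<forall>i<5. ?d i \<ge> 0" by simp
  from zero_factor_iff[OF this]
  have "(\<exists>i<5. ?d i = 0) \<longleftrightarrow> (\<exists>t\<in>T B. t = 0)"
    unfolding P T_def ex5[of "\<lambda>k. coeff _ k = 0"] co by blast
  moreover have "(\<exists>i<5. ?d i = 0) \<longleftrightarrow> (\<exists>i<5. c i = B)" by (auto simp: algebra_simps)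
  ultimately show "(\<exists>i<5. c i = B) \<longleftrightarrow> (\<exists>t\<in>T B. t = 0)" by simp
qed

text \<open>Passing to \<open>- f(- x)\<close> turns lower bounds on the roots into upper
  bounds.\<close>

lemma reflected_factors:
  fixes c :: "nat \<Rightarrow> real"
  assumes f: "[:e0, e1, e2, e3, e4, 1:] = (\<Prod>i<5::nat. [:- c i, 1:])"
  shows "[:- e0, e1, - e2, e3, - e4, 1:] = (\<Prod>i<5::nat. [:- (- c i), 1:])"
proof (rule poly_eq_if_eq_on_Ici)
  fix x
  have "poly [:- e0, e1, - e2, e3, - e4, 1:] x = - poly [:e0, e1, e2, e3, e4, 1:] (- x)"
    by (simp add: algebra_simps)
  also have "\<dots> = (-1) ^ 5 * (\<Prod>i<5::nat. - x - c i)"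
    unfolding f poly_prod by (simp add: minus_diff_commute)
  also have "\<dots> = (\<Prod>i<5::nat. (-1) * (- x - c i))"
    by (simp only: prod.distrib prod_constant card_lessThan)
  also have "\<dots> = (\<Prod>i<5::nat. c i + x)" by simp
  finally show "poly [:- e0, e1, - e2, e3, - e4, 1:] x = poly (\<Prod>i<5::nat. [:- (- c i), 1:]) x"
    unfolding poly_prod by (simp add: add.commute)
qed

section \<open>Shifts, the cubic discriminant and Cardano's formula\<close>

lemma real_rooted_pcompose_shift:
  "real_rooted (pcompose p [:a, 1:]) \<longleftrightarrow> real_rooted p"
proof -
  have imp: "real_rooted (pcompose p [:a, 1:])" if rr: "real_rooted p" for p a
  proof -
    obtain r where r: "p = smult (lead_coeff p) (\<Prod>i<degree p. [:- r i, 1:])"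
      using real_rootedE[OF rr] by metis
    have "lead_coeff p \<noteq> 0" using rr by (auto simp: real_rooted_def)
    moreover have "pcompose p [:a, 1:] = smult (lead_coeff p) (\<Prod>i<degree p. [:- (r i - a), 1:])"
      by (subst r) (simp add: pcompose_smult pcompose_prod pcompose_pCons)
    ultimately show ?thesis by (rule real_rootedI[rotated])
  qed
  have "pcompose (pcompose p [:a, 1:]) [:-a, 1:] = p"
    by (simp add: pcompose_assoc[symmetric] pcompose_pCons)
  with imp[of p a] imp[of "pcompose p [:a, 1:]" "-a"] show ?thesis by auto
qed

lemma real_rooted_monicE:
  assumes "real_rooted p" "degree p = n" "lead_coeff p = 1"
  obtains r where "\<And>i j. i \<le> j \<Longrightarrow> j < n \<Longrightarrow> r i \<le> r j" "p = (\<Prod>i<n. [:- r i, 1:])"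
  using real_rootedE[OF assms(1)] assms(2,3) by (metis smult_1_left)

text \<open>The expression is \<open>-1/27\<close> times the discriminant, which is the squared
  product of root differences.\<close>

lemma depressed_cubic_discriminant:
  assumes "real_rooted [:u3, u2, 0, 1:]"
  shows "u3 ^ 2 + 4 / 27 * u2 ^ 3 \<le> 0"
proof -
  obtain b where "[:u3, u2, 0, 1:] = (\<Prod>i<3::nat. [:- b i, 1:])"
    by (rule real_rooted_monicE[OF assms, of 3]) auto
  then have "u3 = - b 0 * b 1 * b 2" "u2 = b 0 * b 1 + b 0 * b 2 + b 1 * b 2" "b 0 + b 1 + b 2 = 0"
    by (simp_all add: eval_nat_numeral algebra_simps)
  then have "- 4 * u2 ^ 3 - 27 * u3\<^sup>2 = ((b 0 - b 1) * (b 0 - b 2) * (b 1 - b 2))\<^sup>2"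
    by algebra
  also have "\<dots> \<ge> 0" by simp
  finally show ?thesis by simp
qed

text \<open>When the discriminant is nonpositive, \<open>sd\<close> is purely imaginary, so the second cube root in
  Cardano's formula is the conjugate of \<open>om\<close> and the three roots \<open>\<beta> k\<close> are real.\<close>
lemma cardano_real_roots:
  fixes zt sd om :: complex and u2 u3 :: real
  assumes zt: "zt ^ 3 = 1" "zt \<noteq> 1"
    and sd: "sd\<^sup>2 = complex_of_real (u3 ^ 2 + 4 / 27 * u2 ^ 3)"
    and om: "om ^ 3 = (- complex_of_real u3 + sd) / 2"
    and disc: "u3 ^ 2 + 4 / 27 * u2 ^ 3 \<le> 0"
  defines "\<beta> \<equiv> \<lambda>k::nat. zt ^ k * om + inverse zt ^ k * cnj om"
  shows "\<beta> k \<in> \<real>" "map_poly complex_of_real [:u3, u2, 0, 1:] = (\<Prod>k<3. [:- \<beta> k, 1:])"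
    "- (zt ^ k * om * (9 * complex_of_real u3 / 2 + 3 * sd / 2))
       - (inverse zt) ^ k * cnj om * (9 * complex_of_real u3 / 2 - 3 * sd / 2)
       + complex_of_real (2 * u2 ^ 2 / 3) = - complex_of_real u2 * (\<beta> k)\<^sup>2 - 3 * complex_of_real u3 * \<beta> k"
proof -
  have "cmod zt ^ 3 = 1" using zt(1) by (metis norm_one norm_power)
  then have "cmod zt = 1" using power_eq_iff_eq_base[of 3 "cmod zt" 1] by simp
  then have inv: "inverse zt = cnj zt" 
    by (metis complex_div_cnj inverse_eq_divide mult_1 of_real_1 power_one div_by_1)
  have zz: "zt * inverse zt = 1" using zt(1) by (intro right_inverse) auto
  have iz: "inverse zt = zt\<^sup>2"
    using zz zt(1) by (metis inverse_unique power2_eq_square power3_eq_cube mult.assoc)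
  have "(zt - 1) * (zt\<^sup>2 + zt + 1) = 0" using zt(1) by algebra
  then have zt2: "zt\<^sup>2 + zt + 1 = 0" using zt(2) by simp
  have "cnj (\<beta> k) = \<beta> k" for k unfolding \<beta>_def inv by simp
  then show "\<beta> k \<in> \<real>" by (simp add: Reals_cnj_iff)
  have u2: "u2 \<le> 0"
  proof (rule ccontr)
    assume "\<not> u2 \<le> 0"
    then have "u2 ^ 3 > 0" by simp
    with disc zero_le_power2[of u3] show False by linarith
  qed
  define m where "m = sqrt (- (u3 ^ 2 + 4 / 27 * u2 ^ 3))"
  have m2: "m\<^sup>2 = - (u3 ^ 2 + 4 / 27 * u2 ^ 3)" using disc by (simp add: m_def)
  have "(sd - \<i> * of_real m) * (sd + \<i> * of_real m) = sd\<^sup>2 + of_real (m\<^sup>2)"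
    by (simp add: algebra_simps power2_eq_square)
  also have "\<dots> = 0" unfolding m2 sd by simp
  finally have "sd = \<i> * of_real m \<or> sd = - \<i> * of_real m" by (auto simp: add_eq_0_iff)
  then have cnj_sd: "cnj sd = - sd" by auto
  \<comment> \<open>By \<open>cnj sd = - sd\<close>, the sixth power of \<open>cmod om\<close> is
    \<open>(u3^2 - sd^2) / 4 = (- u2 / 3)^3\<close>. As \<open>- u2 / 3\<close> is nonnegative, the
    cubes cancel over the reals, so \<open>cnj om\<close> meets Cardano's compatibility condition
    \<open>om * cnj om = - u2 / 3\<close>.\<close>
  have "(cmod om ^ 2) ^ 3 = cmod (om ^ 3) ^ 2" by (simp add: norm_power flip: power_mult)
  then have "complex_of_real ((cmod om ^ 2) ^ 3) = of_real (cmod (om ^ 3) ^ 2)" by (rule arg_cong)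
  also have "\<dots> = (om ^ 3) * cnj (om ^ 3)" by (rule complex_norm_square)
  also have "\<dots> = (of_real (u3\<^sup>2) - sd\<^sup>2) / 4"
    unfolding om by (simp add: cnj_sd power2_eq_square algebra_simps)
  also have "\<dots> = of_real ((- u2 / 3) ^ 3)"
    unfolding sd by (simp add: power3_eq_cube)
  finally have "(cmod om ^ 2) ^ 3 = (- u2 / 3) ^ 3" unfolding of_real_eq_iff .
  then have "cmod om ^ 2 = - u2 / 3" using u2
    using power_eq_iff_eq_base[of 3 "cmod om ^ 2" "- u2 / 3"] by simp
  then have oc: "om * cnj om = - of_real u2 / 3"
    unfolding complex_norm_square[symmetric] by simp
  define u where "u = complex_of_real u2"
  define v where "v = complex_of_real u3"
  define oc' where "oc' = cnj om"
  have om3: "2 * om ^ 3 = - v + sd" unfolding om v_def by simp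
  have "oc' ^ 3 = cnj (om ^ 3)" by (simp add: oc'_def)
  also have "cnj (om ^ 3) = (- v - sd) / 2" unfolding om by (simp add: cnj_sd v_def)
  finally have oc3: "2 * oc' ^ 3 = - v - sd" by (simp add: field_simps)
  have oc': "3 * om * oc' = - u" using oc by (simp add: u_def oc'_def mult.assoc)
  have b: "\<beta> 0 = om + oc'" "\<beta> 1 = zt * om + zt\<^sup>2 * oc'" "\<beta> 2 = zt\<^sup>2 * om + zt * oc'"
  proof -
    have "(zt\<^sup>2)\<^sup>2 = zt" using zt(1) by algebra
    then show "\<beta> 0 = om + oc'" "\<beta> 1 = zt * om + zt\<^sup>2 * oc'" "\<beta> 2 = zt\<^sup>2 * om + zt * oc'"
      by (simp_all add: \<beta>_def iz oc'_def)
  qed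
  have s1: "\<beta> 0 + \<beta> 1 + \<beta> 2 = 0" unfolding b using zt2 by algebra
  have "\<beta> 0 * \<beta> 1 + \<beta> 0 * \<beta> 2 + \<beta> 1 * \<beta> 2 = - (3 * om * oc')"
    unfolding b using zt2 by algebra
  then have s2: "u = \<beta> 0 * \<beta> 1 + \<beta> 0 * \<beta> 2 + \<beta> 1 * \<beta> 2" using oc' by simp
  have "\<beta> 0 * \<beta> 1 * \<beta> 2 = om ^ 3 + oc' ^ 3"
    unfolding b using zt2 by algebra
  then have "2 * (\<beta> 0 * \<beta> 1 * \<beta> 2) = 2 * om ^ 3 + 2 * oc' ^ 3" by simp
  then have s3: "v = - (\<beta> 0 * \<beta> 1 * \<beta> 2)" unfolding om3 oc3 by algebra
  have s1': "\<beta> 2 = - \<beta> 0 - \<beta> 1" using s1 by algebra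
  have "[:v, u, 0, 1:] = [:- \<beta> 0, 1:] * [:- \<beta> 1, 1:] * [:- \<beta> 2, 1:]"
    unfolding s2 s3 s1' by (simp add: algebra_simps)
  also have "\<dots> = (\<Prod>k<3::nat. [:- \<beta> k, 1:])" 
    by (simp add: numeral_3_eq_3 numeral_2_eq_2 del: mult_pCons_left mult_pCons_right)
  finally have "[:v, u, 0, 1:] = (\<Prod>k<3::nat. [:- \<beta> k, 1:])" .
  then show "map_poly complex_of_real [:u3, u2, 0, 1:] = (\<Prod>k<3. [:- \<beta> k, 1:])"
    by (simp add: map_poly_pCons u_def v_def)
  define z z' where "z = zt ^ k" and "z' = inverse zt ^ k"
  have "z * z' = 1" using zz by (simp add: z_def z'_def flip: power_mult_distrib)
  moreover have z3: "z ^ 3 = 1" using zt(1) unfolding z_def by (metis power_mult power_one mult.commute)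
  moreover have "z ^ 3 * z' ^ 3 = 1" using \<open>z * z' = 1\<close> by (metis power_mult_distrib power_one)
  ultimately have zs: "z * z' = 1" "z ^ 3 = 1" "z' ^ 3 = 1" by simp_all
  \<comment> \<open>The pair \<open>z * om\<close>, \<open>z' * oc'\<close> satisfies the same
    relations as \<open>om\<close>, \<open>oc'\<close>, so one identity in two variables
    \<open>a\<close>, \<open>b\<close> settles every \<open>k\<close>.\<close>
  have v: "v = - ((z * om) ^ 3 + (z' * oc') ^ 3)"
    unfolding power_mult_distrib zs using om3 oc3 by algebra
  have sd': "sd = (z * om) ^ 3 - (z' * oc') ^ 3"
    unfolding power_mult_distrib zs using om3 oc3 by algebra
  have u: "u = - 3 * (z * om) * (z' * oc')"
    using oc' zs(1) by algebra
  have "- (a * (9 * v / 2 + 3 * sd / 2)) - b * (9 * v / 2 - 3 * sd / 2) + 2 * u\<^sup>2 / 3 =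
      - u * (a + b)\<^sup>2 - 3 * v * (a + b)"
    if "v = - (a ^ 3 + b ^ 3)" "sd = a ^ 3 - b ^ 3" "u = - 3 * a * b" for a b
    unfolding that by (simp add: field_simps power2_eq_square power3_eq_cube)
  from this[OF v sd' u] have "- (z * om * (9 * v / 2 + 3 * sd / 2)) - z' * oc' * (9 * v / 2 - 3 * sd / 2) + 2 * u\<^sup>2 / 3 =
     - u * (z * om + z' * oc')\<^sup>2 - 3 * v * (z * om + z' * oc')" .
  then show "- (zt ^ k * om * (9 * complex_of_real u3 / 2 + 3 * sd / 2))
       - (inverse zt) ^ k * cnj om * (9 * complex_of_real u3 / 2 - 3 * sd / 2)
       + complex_of_real (2 * u2 ^ 2 / 3) = - complex_of_real u2 * (\<beta> k)\<^sup>2 - 3 * complex_of_real u3 * \<beta> k"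
    by (simp add: \<beta>_def z_def z'_def oc'_def u_def v_def)
qed

section \<open>Cardano and Ferrari formulas\<close>

text \<open>For \<open>u3 = 0\<close> the quartic is quadratic in \<open>x^2\<close>, with
  \<open>x^2 = - u2 + r\<close> or \<open>x^2 = - u2 - r\<close>. The list order is that of the sign
  pairs \<open>(1, 1), (1, -1), (-1, 1), (-1, -1)\<close>.\<close>

lemma ferrari_biquadratic:
  fixes u2 u4 r t1 t2 :: complex
  assumes "r\<^sup>2 = u2\<^sup>2 - u4" "t1\<^sup>2 = - u2 + r" "t2\<^sup>2 = - u2 - r"
  shows "[:u4, 0, 2 * u2, 0, 1:] = (\<Prod>x\<leftarrow>[t1, t2, - t1, - t2]. [:- x, 1:])"
proof -
  have "2 * u2 = - (t1\<^sup>2 + t2\<^sup>2)" "2 * r = t1\<^sup>2 - t2\<^sup>2"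
    using assms(2,3) by algebra+
  then have u2: "u2 = - (t1\<^sup>2 + t2\<^sup>2) / 2" and "r = (t1\<^sup>2 - t2\<^sup>2) / 2"
    by (simp_all add: field_simps)
  with assms(1) have u4: "u4 = t1\<^sup>2 * t2\<^sup>2"
    by (simp add: field_simps power2_eq_square)
  show ?thesis unfolding u2 u4 by (simp add: field_simps power2_eq_square)
qed

text \<open>With \<open>D = v2 / (3 C)\<close> one has
  \<open>(C - D)^3 + 3 C D (C - D) = C^3 - D^3\<close>, and the choice of \<open>C\<close> makes the
  right-hand side \<open>- v3\<close>.\<close>

lemma cardano_resolvent_root:
  fixes C v2 v3 w :: complex
  assumes C: "if v2 = 0 then C ^ 3 = - v3 else C ^ 3 = (- v3 + w) / 2"
    and w: "w\<^sup>2 = v3\<^sup>2 + 4 / 27 * v2 ^ 3"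
  defines "Y \<equiv> C - v2 / (3 * C)"
  shows "Y ^ 3 + v2 * Y + v3 = 0"
proof (cases "v2 = 0")
  case False
  then have C3: "2 * C ^ 3 = - v3 + w" using C by (simp add: field_simps)
  have "C \<noteq> 0"
  proof
    assume "C = 0"
    with C3 have "w = v3" by simp
    with w False show False by simp
  qed
  define D where "D = v2 / (3 * C)"
  have v2: "v2 = 3 * C * D" using \<open>C \<noteq> 0\<close> by (simp add: D_def)
  have "(2 * C ^ 3 + v3)\<^sup>2 = v3\<^sup>2 + 4 * C ^ 3 * D ^ 3"
    unfolding C3 using w unfolding v2 by (simp add: power_mult_distrib)
  then have "4 * C ^ 3 * (C ^ 3 + v3 - D ^ 3) = 0" by algebra
  with \<open>C \<noteq> 0\<close> have "C ^ 3 + v3 - D ^ 3 = 0" by simp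
  moreover have "Y = C - D" by (simp add: Y_def D_def)
  ultimately show ?thesis unfolding v2 by algebra
\<comment> \<open>For \<open>v2 = 0\<close> the subtracted quotient is 0, even if
  \<open>C = 0\<close>, so \<open>Y = C\<close>.\<close>
qed (use C in \<open>simp add: Y_def\<close>)

text \<open>The resolvent equation for \<open>y\<close> makes the quartic a difference of squares,
  \<open>(x^2 + u2 + y)^2 - (z x - 2 u3 / z)^2\<close>. Its two quadratic factors have linear
  coefficients \<open>- z\<close> and \<open>z\<close> and discriminants \<open>s1^2\<close> and
  \<open>s2^2\<close>.\<close>

lemma ferrari_quartic:
  fixes u2 u3 u4 y z s1 s2 :: complex
  assumes y: "y ^ 3 + 2 * u2 * y\<^sup>2 + (u2\<^sup>2 - u4) * y - 2 * u3\<^sup>2 = 0" and "u3 \<noteq> 0"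
    and z: "z\<^sup>2 = 2 * y"
    and s: "s1\<^sup>2 = - 4 * u2 - 2 * y - 8 * u3 / z" "s2\<^sup>2 = - 4 * u2 - 2 * y + 8 * u3 / z"
  shows "[:u4, 4 * u3, 2 * u2, 0, 1:] =
    (\<Prod>x\<leftarrow>[(z + s1) / 2, (z - s1) / 2, (- z + s2) / 2, (- z - s2) / 2]. [:- x, 1:])"
proof -
  \<comment> \<open>If \<open>z = 0\<close>, then \<open>y = 0\<close> and the resolvent equation
    reduces to \<open>u3 = 0\<close>.\<close>
  have "z \<noteq> 0" using y z \<open>u3 \<noteq> 0\<close> by auto
  define k where "k = u3 / z"
  have u3: "u3 = k * z" using \<open>z \<noteq> 0\<close> by (simp add: k_def)
  have yz: "y = z\<^sup>2 / 2" using z by simp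
  have s1: "s1\<^sup>2 = - 4 * u2 - z\<^sup>2 - 8 * k" and s2: "s2\<^sup>2 = - 4 * u2 - z\<^sup>2 + 8 * k"
    using s by (simp_all add: k_def yz)
  have "z\<^sup>2 * ((z\<^sup>2 / 2 + u2)\<^sup>2 - 4 * k\<^sup>2 - u4) =
      2 * (y ^ 3 + 2 * u2 * y\<^sup>2 + (u2\<^sup>2 - u4) * y - 2 * u3\<^sup>2)"
    unfolding yz u3 by (simp add: field_simps power2_eq_square power3_eq_cube)
  then have "z\<^sup>2 * ((z\<^sup>2 / 2 + u2)\<^sup>2 - 4 * k\<^sup>2 - u4) = 0" unfolding y by simp
  with \<open>z \<noteq> 0\<close> have u4: "u4 = (z\<^sup>2 / 2 + u2)\<^sup>2 - 4 * k\<^sup>2" by simp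
  have f1: "[:- ((z + s1) / 2), 1:] * [:- ((z - s1) / 2), 1:] = [:(z\<^sup>2 - s1\<^sup>2) / 4, - z, 1:]"
    by (simp add: field_simps power2_eq_square)
  have f2: "[:- ((- z + s2) / 2), 1:] * [:- ((- z - s2) / 2), 1:] = [:(z\<^sup>2 - s2\<^sup>2) / 4, z, 1:]"
    by (simp add: field_simps power2_eq_square)
  have "(\<Prod>x\<leftarrow>[(z + s1) / 2, (z - s1) / 2, (- z + s2) / 2, (- z - s2) / 2]. [:- x, 1:]) =
      [:(z\<^sup>2 - s1\<^sup>2) / 4, - z, 1:] * [:(z\<^sup>2 - s2\<^sup>2) / 4, z, 1:]"
    unfolding f1[symmetric] f2[symmetric]
    by (simp add: mult.assoc del: mult_pCons_left mult_pCons_right)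
  also have "\<dots> = [:u4, 4 * u3, 2 * u2, 0, 1:]"
    unfolding s1 s2 u3 u4 by (simp add: field_simps power2_eq_square)
  finally show ?thesis by simp
qed

section \<open>Intervals for the constant terms of the quartic and the quintic\<close>

lemma prod_list_factors_sort:
  fixes xs :: "real list"
  shows "(\<Prod>x\<leftarrow>xs. [:- x, 1:]) = (\<Prod>i<length xs. [:- (sort xs ! i), 1:])"
proof -
  have "(\<Prod>x\<leftarrow>xs. [:- x, 1:]) = (\<Prod>x\<leftarrow>sort xs. [:- x, 1:])"
    by (simp flip: prod_mset_prod_list)
  also have "\<dots> = (\<Prod>i<length xs. [:- (sort xs ! i), 1:])"
    by (subst prod.list_conv_set_nth) (auto simp: atLeast0LessThan)
  finally show ?thesis .
qed

lemma sort_map_sort: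
  fixes xs :: "'a::linorder list"
  shows "sort (map f (sort xs)) = sort (map f xs)"
  by (rule properties_for_sort) simp_all

text \<open>A critical point \<open>b\<close> satisfies \<open>b^4 = - u2 b^2 - u3 b\<close>, so the
  quartic takes the value \<open>u4 - (- u2 b^2 - 3 u3 b)\<close> there. Thus the entries of
  \<open>th\<close> are the values of \<open>u4\<close> at which some critical point becomes a
  root.\<close>

lemma real_rooted_quartic_iff:
  fixes u2 u3 u4 :: real and xs :: "real list"
  assumes K: "[:u3, u2, 0, 1:] = (\<Prod>x\<leftarrow>xs. [:- x, 1:])" and "length xs = 3"
  defines "th \<equiv> sort (map (\<lambda>b. - u2 * b\<^sup>2 - 3 * u3 * b) xs)"
  shows "real_rooted [:u4, 4 * u3, 2 * u2, 0, 1:] \<longleftrightarrow> th ! 0 \<le> u4 \<and> u4 \<le> th ! 1"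
proof -
  let ?\<phi> = "\<lambda>b. - u2 * b\<^sup>2 - 3 * u3 * b"
  let ?P = "[:u4, 4 * u3, 2 * u2, 0, 1:]"
  have "\<exists>a b c. ys = [a, b, c]" if "length ys = 3" for ys :: "real list"
    using that by (auto simp: numeral_3_eq_3 length_Suc_conv)
  from this[of "sort xs"] obtain a b c where abc: "sort xs = [a, b, c]"
    using \<open>length xs = 3\<close> by auto
  have le: "a \<le> b" "b \<le> c" using sorted_sort[of xs] unfolding abc by simp_all
  have Kf: "[:u3, u2, 0, 1:] = (\<Prod>i<3. [:- (sort xs ! i), 1:])"
    using K prod_list_factors_sort[of xs] \<open>length xs = 3\<close> by simp
  then have "[:u3, u2, 0, 1:] = [:- a, 1:] * [:- b, 1:] * [:- c, 1:]"
    unfolding abc by (simp add: numeral_3_eq_3)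
  then have coeffs: "u3 = - a * b * c" "u2 = a * b + a * c + b * c" "c = - a - b"
    by (simp_all add: algebra_simps)
  then have ac: "a \<le> 0" "c \<ge> 0" using le by simp_all
  \<comment> \<open>The critical points sum to 0, so \<open>a \<le> 0 \<le> c\<close>. Hence the
    middle one gives the least threshold, and the upper bound is the smaller of the other
    two.\<close>
  have "?\<phi> a - ?\<phi> b = c * (b - a) ^ 3" using coeffs by algebra
  moreover have "c * (b - a) ^ 3 \<ge> 0" using le ac by simp
  ultimately have ab: "?\<phi> b \<le> ?\<phi> a" by linarith
  have "?\<phi> c - ?\<phi> b = (- a) * (c - b) ^ 3" using coeffs by algebra
  moreover have "(- a) * (c - b) ^ 3 \<ge> 0" using le ac by (intro mult_nonneg_nonneg) auto
  ultimately have cb: "?\<phi> b \<le> ?\<phi> c" by linarith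
  have th: "th = sort [?\<phi> a, ?\<phi> b, ?\<phi> c]"
    unfolding th_def sort_map_sort[of ?\<phi> xs, symmetric] abc by simp
  have "pderiv ?P = smult 4 [:u3, u2, 0, 1:]" by (simp add: pderiv_pCons)
  then have "pderiv ?P = smult 4 (\<Prod>i<3. [:- (sort xs ! i), 1:])" unfolding Kf .
  then have "real_rooted ?P \<longleftrightarrow> (\<forall>i<3. (-1) ^ (3 - i) * poly ?P (sort xs ! i) \<ge> 0)"
    by (rule real_rooted_iff_alternating_values)
      (use \<open>length xs = 3\<close> in \<open>auto intro: sorted_nth_mono\<close>)
  also have "\<dots> \<longleftrightarrow> poly ?P a \<le> 0 \<and> poly ?P b \<ge> 0 \<and> poly ?P c \<le> 0"
    unfolding abc by (auto simp: less_Suc_eq numeral_3_eq_3 simp del: poly_pCons)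
  moreover have "poly ?P a = u4 - ?\<phi> a" "poly ?P b = u4 - ?\<phi> b" "poly ?P c = u4 - ?\<phi> c"
    using coeffs unfolding poly_pCons poly_0 by algebra+
  ultimately have "real_rooted ?P \<longleftrightarrow> u4 \<le> ?\<phi> a \<and> ?\<phi> b \<le> u4 \<and> u4 \<le> ?\<phi> c"
    by (simp only: diff_le_0_iff_le diff_ge_0_iff_ge)
  then show ?thesis unfolding th using ab cb by (auto simp: insort_key.simps)
qed

text \<open>The value of the quintic at \<open>z\<close> is \<open>e - H z\<close>, so alternation
  bounds \<open>e\<close> from below at the first and third critical points and from above at the
  other two. The order within each pair is left open, hence \<open>max\<close> and
  \<open>min\<close>.\<close>

lemma real_rooted_quintic_iff:
  fixes u2 u3 u4 e :: real and xs :: "real list"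
  assumes P: "[:u4, 4 * u3, 2 * u2, 0, 1:] = (\<Prod>x\<leftarrow>xs. [:- x, 1:])" and "length xs = 4"
  defines "g \<equiv> sort xs"
    and "H \<equiv> (\<lambda>z::real. - (z ^ 5) - 10 / 3 * u2 * z ^ 3 - 10 * u3 * z ^ 2 - 5 * u4 * z)"
  shows "real_rooted [:e, 5 * u4, 10 * u3, 10 / 3 * u2, 0, 1:] \<longleftrightarrow>
    max (H (g ! 0)) (H (g ! 2)) \<le> e \<and> e \<le> min (H (g ! 1)) (H (g ! 3))"
proof -
  let ?F = "[:e, 5 * u4, 10 * u3, 10 / 3 * u2, 0, 1:]"
  have "pderiv ?F = smult 5 [:u4, 4 * u3, 2 * u2, 0, 1:]" by (simp add: pderiv_pCons)
  then have "pderiv ?F = smult 5 (\<Prod>i<4. [:- (g ! i), 1:])"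
    unfolding P g_def prod_list_factors_sort \<open>length xs = 4\<close> .
  then have "real_rooted ?F \<longleftrightarrow> (\<forall>i<4. (-1) ^ (4 - i) * poly ?F (g ! i) \<ge> 0)"
    by (rule real_rooted_iff_alternating_values)
      (use \<open>length xs = 4\<close> in \<open>auto intro: sorted_nth_mono simp: g_def\<close>)
  also have "\<dots> \<longleftrightarrow> poly ?F (g ! 0) \<ge> 0 \<and> poly ?F (g ! 1) \<le> 0 \<and> poly ?F (g ! 2) \<ge> 0 \<and> poly ?F (g ! 3) \<le> 0"
    by (auto simp: less_Suc_eq eval_nat_numeral simp del: poly_pCons)
  also have "poly ?F = (\<lambda>z. e - H z)"
    by (rule ext) (simp add: H_def algebra_simps eval_nat_numeral)
  finally show ?thesis by auto
qed

text \<open>For \<open>s = sqrt q\<close> these are the Taylor coefficients of \<open>trace_poly\<close> at \<open>2 * s\<close>; negating the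
  coefficients of odd index gives, up to sign, those at \<open>- 2 * s\<close>.\<close>
definition trace_bounds :: "real \<Rightarrow> real \<Rightarrow> real \<Rightarrow> real \<Rightarrow> real \<Rightarrow> real \<Rightarrow> real list" where
  "trace_bounds s A1 A2 A3 A4 A5 =
    [A1 + 10 * s, A2 + 8 * s * A1 + 35 * s\<^sup>2,
     A3 + 20 * s\<^sup>2 * A1 + 6 * s * A2 + 50 * s ^ 3,
     A4 + 9 * s\<^sup>2 * A2 + 25 * s ^ 4 + 4 * s * (4 * s\<^sup>2 * A1 + A3),
     A5 + 2 * s * A4 + 2 * s\<^sup>2 * A3 + 2 * s ^ 3 * A2 + 2 * s ^ 4 * A1 + 2 * s ^ 5]"

text \<open>Two-sided bounds are two one-sided ones, for \<open>f\<close> and for its reflection.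
  Writing \<open>s^2\<close> for \<open>q\<close> reduces the comparison of coefficients to
  polynomial identities.\<close>

lemma trace_poly_eq_factors_bounds:
  fixes c :: "nat \<Rightarrow> real"
  assumes f: "trace_poly q a1 a2 a3 a4 a5 = (\<Prod>i<5. [:- c i, 1:])"
  defines "s \<equiv> sqrt (real q)"
  defines "T \<equiv> set (trace_bounds s (of_int a1) (of_int a2) (of_int a3) (of_int a4) (of_int a5)) \<union>
    set (trace_bounds s (- of_int a1) (of_int a2) (- of_int a3) (of_int a4) (- of_int a5))"
  shows "(\<forall>i<5. \<bar>c i\<bar> \<le> 2 * s) \<longleftrightarrow> (\<forall>t\<in>T. t \<ge> 0)"
    "(\<forall>i<5. \<bar>c i\<bar> \<le> 2 * s) \<Longrightarrow> (\<exists>i<5. c i = 2 * s \<or> c i = - 2 * s) \<longleftrightarrow> (\<exists>t\<in>T. t = 0)"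
proof -
  have q: "real q = s\<^sup>2" by (simp add: s_def)
  note up = f[unfolded trace_poly_def q]
  note dn = reflected_factors[OF up]
  \<comment> \<open>The left-hand side is spelled as the instance of \<open>T (2 * s)\<close> for
    the coefficients of \<open>f\<close>, because this equation serves to rewrite
    \<open>coeffs_nonneg_iff_roots_le\<close>; \<open>D\<close> does the same for the
    reflection.\<close>
  have U: "{of_int a1 + 5 * (2 * s), of_int a2 - 5 * s\<^sup>2 + 4 * of_int a1 * (2 * s) + 10 * (2 * s)\<^sup>2,
      of_int a3 - 4 * s\<^sup>2 * of_int a1 + 3 * (of_int a2 - 5 * s\<^sup>2) * (2 * s) + 6 * of_int a1 * (2 * s)\<^sup>2 + 10 * (2 * s) ^ 3,
      of_int a4 - 3 * s\<^sup>2 * of_int a2 + 5 * (s\<^sup>2)\<^sup>2 + 2 * (of_int a3 - 4 * s\<^sup>2 * of_int a1) * (2 * s) +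
        3 * (of_int a2 - 5 * s\<^sup>2) * (2 * s)\<^sup>2 + 4 * of_int a1 * (2 * s) ^ 3 + 5 * (2 * s) ^ 4,
      of_int a5 - 2 * s\<^sup>2 * of_int a3 + 2 * (s\<^sup>2)\<^sup>2 * of_int a1 +
        (of_int a4 - 3 * s\<^sup>2 * of_int a2 + 5 * (s\<^sup>2)\<^sup>2) * (2 * s) + (of_int a3 - 4 * s\<^sup>2 * of_int a1) * (2 * s)\<^sup>2 +
        (of_int a2 - 5 * s\<^sup>2) * (2 * s) ^ 3 + of_int a1 * (2 * s) ^ 4 + (2 * s) ^ 5} =
      set (trace_bounds s (of_int a1) (of_int a2) (of_int a3) (of_int a4) (of_int a5))"
    unfolding trace_bounds_def list.set
    by (intro arg_cong2[of _ _ _ _ insert]) (simp_all add: algebra_simps eval_nat_numeral)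
  have D: "{- of_int a1 + 5 * (2 * s), of_int a2 - 5 * s\<^sup>2 + 4 * (- of_int a1) * (2 * s) + 10 * (2 * s)\<^sup>2,
      - (of_int a3 - 4 * s\<^sup>2 * of_int a1) + 3 * (of_int a2 - 5 * s\<^sup>2) * (2 * s) + 6 * (- of_int a1) * (2 * s)\<^sup>2 + 10 * (2 * s) ^ 3,
      of_int a4 - 3 * s\<^sup>2 * of_int a2 + 5 * (s\<^sup>2)\<^sup>2 + 2 * (- (of_int a3 - 4 * s\<^sup>2 * of_int a1)) * (2 * s) +
        3 * (of_int a2 - 5 * s\<^sup>2) * (2 * s)\<^sup>2 + 4 * (- of_int a1) * (2 * s) ^ 3 + 5 * (2 * s) ^ 4,
      - (of_int a5 - 2 * s\<^sup>2 * of_int a3 + 2 * (s\<^sup>2)\<^sup>2 * of_int a1) +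
        (of_int a4 - 3 * s\<^sup>2 * of_int a2 + 5 * (s\<^sup>2)\<^sup>2) * (2 * s) + (- (of_int a3 - 4 * s\<^sup>2 * of_int a1)) * (2 * s)\<^sup>2 +
        (of_int a2 - 5 * s\<^sup>2) * (2 * s) ^ 3 + (- of_int a1) * (2 * s) ^ 4 + (2 * s) ^ 5} =
      set (trace_bounds s (- of_int a1) (of_int a2) (- of_int a3) (of_int a4) (- of_int a5))"
    unfolding trace_bounds_def list.set
    by (intro arg_cong2[of _ _ _ _ insert]) (simp_all add: algebra_simps eval_nat_numeral)
  note U' = coeffs_nonneg_iff_roots_le[OF up, of "2 * s", unfolded U]
  note D' = coeffs_nonneg_iff_roots_le[OF dn, of "2 * s", unfolded D]
  have split: "(\<forall>i<5. \<bar>c i\<bar> \<le> 2 * s) \<longleftrightarrow> (\<forall>i<5. c i \<le> 2 * s) \<and> (\<forall>i<5. - c i \<le> 2 * s)"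
    by (auto simp: abs_le_iff)
  show "(\<forall>i<5. \<bar>c i\<bar> \<le> 2 * s) \<longleftrightarrow> (\<forall>t\<in>T. t \<ge> 0)"
    unfolding split U'(1) D'(1) T_def by blast
  assume "\<forall>i<5. \<bar>c i\<bar> \<le> 2 * s"
  then have "\<forall>i<5. c i \<le> 2 * s" "\<forall>i<5. - c i \<le> 2 * s" unfolding split by blast+
  from U'(2)[OF this(1)] D'(2)[OF this(2)]
  have "(\<exists>i<5. c i = 2 * s) \<or> (\<exists>i<5. - c i = 2 * s) \<longleftrightarrow> (\<exists>t\<in>T. t = 0)"
    unfolding T_def by blast
  moreover have "c i = - 2 * s \<longleftrightarrow> - c i = 2 * s" for i by auto
  ultimately show "(\<exists>i<5. c i = 2 * s \<or> c i = - 2 * s) \<longleftrightarrow> (\<exists>t\<in>T. t = 0)" by metis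
qed

section \<open>Real roots of Weil polynomials\<close>

lemma map_poly_of_int_mult:
  "(map_poly of_int (p * q) :: 'a::comm_ring_1 poly) = map_poly of_int p * map_poly of_int q"
  by (rule map_poly_mult_hom) simp_all

lemma map_poly_of_int_power:
  "(map_poly of_int (p ^ n) :: 'a::comm_ring_1 poly) = map_poly of_int p ^ n"
  by (induction n) (simp_all add: map_poly_of_int_mult)

text \<open>For monic \<open>m\<close>, pseudo-division is honest division with remainder over the
  integers. Over the reals the remainder is a multiple of \<open>m\<close> of smaller degree, hence
  0, so the real cofactor is integral.\<close>

lemma monic_int_poly_division:
  assumes "lead_coeff m = 1" "map_poly real_of_int h = map_poly of_int m * k"
  shows "\<exists>h0. h = m * h0 \<and> map_poly of_int h0 = k"
proof -
  let ?R = "map_poly real_of_int"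
  obtain d r where dr: "pseudo_divmod h m = (d, r)" by fastforce
  have "m \<noteq> 0" using assms(1) by auto
  from pseudo_divmod[OF this dr] assms(1)
  have h: "h = m * d + r" and r: "r = 0 \<or> degree r < degree m" by simp_all
  have "?R h = ?R m * ?R d + ?R r"
    unfolding h map_poly_of_int_mult[symmetric] by (rule poly_eqI) (simp add: coeff_map_poly)
  with assms(2) have R: "?R m * (k - ?R d) = ?R r" by (simp add: algebra_simps)
  have deg: "degree (?R p) = degree p" for p by (simp add: degree_map_poly)
  have "?R m \<noteq> 0" using \<open>m \<noteq> 0\<close> by (simp add: map_poly_eq_0_iff)
  have k: "k = ?R d"
  proof (rule ccontr)
    assume "k \<noteq> ?R d"
    then have nz: "k - ?R d \<noteq> 0" by simp
    then have "degree (?R r) = degree (?R m) + degree (k - ?R d)"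
      unfolding R[symmetric] using \<open>?R m \<noteq> 0\<close> by (intro degree_mult_eq)
    then have "r = 0" using r by (simp add: deg)
    with R \<open>?R m \<noteq> 0\<close> nz show False by simp
  qed
  with R have "?R r = 0" by simp
  then have "r = 0" by (simp add: map_poly_eq_0_iff)
  with h k show ?thesis by auto
qed

lemma sqrt_irrational_if_not_square:
  fixes q :: nat
  assumes "\<not> (\<exists>s. q = s\<^sup>2)"
  shows "sqrt (real q) \<notin> \<rat>"
proof
  assume "sqrt (real q) \<in> \<rat>"
  then obtain m n :: nat where mn: "n \<noteq> 0" "\<bar>sqrt (real q)\<bar> = real m / real n" "coprime m n"
    by (rule Rats_abs_nat_div_natE)
  then have "(sqrt (real q) * real n)\<^sup>2 = (real m)\<^sup>2" by simp
  then have "real (q * n\<^sup>2) = real (m\<^sup>2)" by (simp add: power_mult_distrib)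
  then have eq: "q * n\<^sup>2 = m\<^sup>2" by (simp only: of_nat_eq_iff)
  then have "n\<^sup>2 dvd m\<^sup>2" by (metis dvd_triv_right)
  then have "n dvd m" by simp
  with mn(3) have "n = 1" using coprime_common_divisor[of m n n] by simp
  with eq assms show False by auto
qed

lemma irrational_linear_combination:
  fixes x :: real
  assumes "x \<notin> \<rat>" "of_int a + of_int b * x = 0"
  shows "a = 0" "b = 0"
proof -
  show "b = 0"
  proof (rule ccontr)
    assume "b \<noteq> 0"
    then have "x = of_int (- a) / of_int b" using assms(2) by (simp add: field_simps add_eq_0_iff)
    then have "x \<in> \<rat>" by (metis Rats_divide Rats_of_int)
    with assms(1) show False by simp
  qed
  with assms(2) show "a = 0" by simp
qed

text \<open>Replacing \<open>x^2\<close> by \<open>q\<close> gives \<open>h(x) = E + D x\<close>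
  with integers \<open>E\<close> and \<open>D\<close>. Irrationality of \<open>sqrt q\<close> forces
  both to vanish, and then the conjugate is a root as well.\<close>

lemma hpoly_root_neg_sqrt:
  assumes "\<not> (\<exists>s. q = s\<^sup>2)" "e = 1 \<or> e = -1"
    "poly (map_poly of_int (hpoly q a1 a2 a3 a4 a5)) (e * sqrt (real q)) = 0"
  shows "poly (map_poly of_int (hpoly q a1 a2 a3 a4 a5)) (- e * sqrt (real q)) = 0"
proof -
  define S where "S = sqrt (real q)"
  define E where "E = 2 * (int q ^ 5 + a2 * int q ^ 4 + a4 * int q ^ 3)"
  define D where "D = 2 * a1 * int q ^ 4 + 2 * a3 * int q ^ 3 + a5 * int q ^ 2"
  have S2: "S * S = real q" by (simp add: S_def)
  have hp: "poly (map_poly of_int (hpoly q a1 a2 a3 a4 a5)) (f * S) = of_int E + of_int (f' * D) * S"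
    if "f = of_int f'" "f' = 1 \<or> f' = -1" for f :: real and f'
  proof -
    have f: "f * f = 1" using that by auto
    have "(f * S) * (f * S) = (f * f) * (S * S)" by (simp only: ac_simps)
    then have "(f * S) * (f * S) = real q" unfolding f S2 by simp
    then obtain x where x: "x = f * S" "x * x = real q" by blast
    have "poly (map_poly of_int (hpoly q a1 a2 a3 a4 a5)) x =
       real q ^ 5 + of_int a2 * real q ^ 3 * (x * x) + of_int a4 * real q * (x * x)\<^sup>2
       + of_int a4 * (x * x) ^ 3 + of_int a2 * (x * x) ^ 4 + (x * x) ^ 5
       + x * (of_int a1 * real q ^ 4 + of_int a3 * (real q)\<^sup>2 * (x * x) + of_int a5 * (x * x)\<^sup>2
       + of_int a3 * (x * x) ^ 3 + of_int a1 * (x * x) ^ 4)"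
      by (simp add: hpoly_def map_poly_pCons algebra_simps eval_nat_numeral)
    also have "\<dots> = of_int E + of_int D * x"
      unfolding x(2) by (simp add: E_def D_def algebra_simps eval_nat_numeral)
    finally show ?thesis unfolding x(1) that(1) by (simp add: algebra_simps)
  qed
  obtain e' :: int where e': "e = of_int e'" "e' = 1 \<or> e' = -1"
    using assms(2) by (metis of_int_1 of_int_minus)
  then have m: "- e = of_int (- e')" "- e' = 1 \<or> - e' = -1" by auto
  have "of_int E + of_int (e' * D) * S = 0" using assms(3) hp[OF e'] by (simp add: S_def)
  from irrational_linear_combination[OF sqrt_irrational_if_not_square[OF assms(1)] this[unfolded S_def]]
  have "E = 0" "D = 0" using e' by auto
  then show ?thesis using hp[OF m] by (simp add: S_def)
qed

text \<open>The last entry moves into the freed slot \<open>i\<close>. The final clause keeps all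
  other entries available, so that a second factor can be removed afterwards.\<close>

lemma prod_remove_index:
  fixes c :: "nat \<Rightarrow> 'b" and f :: "'b \<Rightarrow> 'a::comm_monoid_mult"
  assumes "i < Suc n"
  shows "\<exists>c'. (\<Prod>j<Suc n. f (c j)) = f (c i) * (\<Prod>j<n. f (c' j)) \<and>
    (\<forall>j<n. \<exists>k<Suc n. c' j = c k) \<and> (\<forall>k<Suc n. k \<noteq> i \<longrightarrow> (\<exists>j<n. c' j = c k))"
proof -
  let ?c' = "\<lambda>j. if j = i then c n else c j"
  have "(\<Prod>j<Suc n. f (c j)) = f (c i) * (\<Prod>j<n. f (?c' j))"
  proof (cases "i = n")
    case False
    then have "i < n" using assms by simp
    have "(\<Prod>j\<in>{..<n}-{i}. f (?c' j)) = (\<Prod>j\<in>{..<n}-{i}. f (c j))"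
      by (rule prod.cong) auto
    then show ?thesis using \<open>i < n\<close>
      by (simp add: lessThan_Suc prod.remove[of "{..<n}" i] ac_simps)
  qed (simp add: lessThan_Suc mult.commute)
  moreover have "\<exists>k<Suc n. ?c' j = c k" if "j < n" for j
    using that by (auto intro: less_SucI)
  moreover have "\<exists>j<n. ?c' j = c k" if "k < Suc n" "k \<noteq> i" for k
    using that assms by (cases "k = n") (auto simp: less_Suc_eq)
  ultimately show ?thesis by (intro exI[of _ ?c']) simp
qed

lemma factors_update:
  "(\<Prod>i<Suc n. f ((c(n := d)) i)) = (\<Prod>i<n. f (c i)) * f d"
  for f :: "'b \<Rightarrow> 'a::comm_monoid_mult"
  by (simp add: lessThan_Suc mult.commute)

lemma poly_factors_eq_0_iff:
  fixes c :: "nat \<Rightarrow> real"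
  assumes "q > 0" "\<forall>i<g. \<bar>c i\<bar> \<le> 2 * sqrt (real q)"
  shows "poly (\<Prod>i<g. [:real q, - c i, 1:]) z = 0 \<longleftrightarrow>
    (\<exists>i<g. c i = 2 * sqrt (real q) \<and> z = sqrt (real q) \<or> c i = - 2 * sqrt (real q) \<and> z = - sqrt (real q))"
proof -
  have "poly (\<Prod>i<g. [:real q, - c i, 1:]) z = 0 \<longleftrightarrow> (\<exists>i<g. real q - c i * z + z\<^sup>2 = 0)"
    by (auto simp: poly_prod power2_eq_square algebra_simps)
  then show ?thesis using real_root_quadratic_iff[of "real q"] assms by auto
qed

section \<open>Adding and splitting off quadratic factors with real roots\<close>

lemma real_factors_square: "[:x\<^sup>2, - (2 * x), 1:] = [:- x, 1:]\<^sup>2" for x :: real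
  by (simp add: power2_eq_square)

lemma real_factors_fourth:
  "[:real q, - (2 * sqrt (real q)), 1:] * [:real q, - (- 2 * sqrt (real q)), 1:] = [:- real q, 0, 1:]\<^sup>2"
proof -
  have "sqrt (real q) * sqrt (real q) = real q" by simp
  then show ?thesis by (simp add: power2_eq_square algebra_simps)
qed

text \<open>The new factor is \<open>x^2 - c x + q\<close> with \<open>c = 2 e s\<close>, an end
  point of the admissible interval; \<open>e\<close> treats both signs at once.\<close>

lemma weil_poly_square_factor:
  assumes "weil_poly (s\<^sup>2) g h0" "e = 1 \<or> e = -1" "s > 0"
  shows "weil_poly (s\<^sup>2) (Suc g) ([:- (e * int s), 1:]\<^sup>2 * h0)"
    "poly (map_poly real_of_int ([:- (e * int s), 1:]\<^sup>2 * h0)) (of_int e * real s) = 0"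
proof -
  let ?x = "of_int e * real s"
  obtain c where c: "\<forall>i<g. \<bar>c i\<bar> \<le> 2 * sqrt (real (s\<^sup>2))" "g > 0"
    "map_poly real_of_int h0 = (\<Prod>i<g. [:real (s\<^sup>2), - c i, 1:])"
    using assms(1) unfolding weil_poly_iff_real_factors by blast
  have x2: "?x\<^sup>2 = real (s\<^sup>2)" and ax: "\<bar>2 * ?x\<bar> \<le> 2 * sqrt (real (s\<^sup>2))"
    using assms(2) by auto
  have m: "map_poly real_of_int ([:- (e * int s), 1:]\<^sup>2 * h0) = [:- ?x, 1:]\<^sup>2 * map_poly real_of_int h0"
    by (simp add: map_poly_of_int_mult map_poly_of_int_power map_poly_pCons)
  show "poly (map_poly real_of_int ([:- (e * int s), 1:]\<^sup>2 * h0)) ?x = 0"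
    unfolding m by simp
  have "map_poly real_of_int ([:- (e * int s), 1:]\<^sup>2 * h0) =
      (\<Prod>i<Suc g. [:real (s\<^sup>2), - (c(g := 2 * ?x)) i, 1:])"
    unfolding m c(3) real_factors_square[symmetric] x2
    using factors_update[of "\<lambda>d. [:real (s\<^sup>2), - d, 1:]" c g "2 * ?x"] by (simp only: mult.commute)
  then show "weil_poly (s\<^sup>2) (Suc g) ([:- (e * int s), 1:]\<^sup>2 * h0)"
    unfolding weil_poly_iff_real_factors using c(1) ax
    by (intro conjI exI[of _ "c(g := 2 * ?x)"]) (auto simp: less_Suc_eq)
qed

text \<open>\<open>(x^2 - q)^2\<close> is the product of the two quadratics with
  \<open>c = 2 sqrt q\<close> and \<open>c = - 2 sqrt q\<close>, which is why \<open>g\<close> grows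
  by two.\<close>

lemma weil_poly_fourth_factor:
  assumes "weil_poly q g h0"
  shows "weil_poly q (Suc (Suc g)) ([:- int q, 0, 1:]\<^sup>2 * h0)"
    "poly (map_poly real_of_int ([:- int q, 0, 1:]\<^sup>2 * h0)) (sqrt (real q)) = 0"
proof -
  obtain c where c: "\<forall>i<g. \<bar>c i\<bar> \<le> 2 * sqrt (real q)" "g > 0"
    "map_poly real_of_int h0 = (\<Prod>i<g. [:real q, - c i, 1:])"
    using assms unfolding weil_poly_iff_real_factors by blast
  have m: "map_poly real_of_int ([:- int q, 0, 1:]\<^sup>2 * h0) = [:- real q, 0, 1:]\<^sup>2 * map_poly real_of_int h0"
    by (simp add: map_poly_of_int_mult map_poly_of_int_power map_poly_pCons)
  show "poly (map_poly real_of_int ([:- int q, 0, 1:]\<^sup>2 * h0)) (sqrt (real q)) = 0"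
    unfolding m by simp
  define c' where "c' = (c(g := 2 * sqrt (real q)))(Suc g := - 2 * sqrt (real q))"
  have "map_poly real_of_int ([:- int q, 0, 1:]\<^sup>2 * h0) = (\<Prod>i<Suc (Suc g). [:real q, - c' i, 1:])"
    unfolding m c(3) real_factors_fourth[symmetric] c'_def
    by (subst factors_update[of "\<lambda>d. [:real q, - d, 1:]"], subst factors_update[of "\<lambda>d. [:real q, - d, 1:]"])
       (simp only: ac_simps)
  then show "weil_poly q (Suc (Suc g)) ([:- int q, 0, 1:]\<^sup>2 * h0)"
    unfolding weil_poly_iff_real_factors using c(1)
    by (intro conjI exI[of _ c']) (auto simp: less_Suc_eq c'_def)
qed

lemma weil_poly_square_factorE:
  assumes "weil_poly (s\<^sup>2) (Suc g) h" "g > 0" "s > 0" "poly (map_poly real_of_int h) z = 0"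
  obtains e h0 where "e = 1 \<or> e = -1" "weil_poly (s\<^sup>2) g h0" "h = [:- (e * int s), 1:]\<^sup>2 * h0"
proof -
  obtain c where c: "\<forall>i<Suc g. \<bar>c i\<bar> \<le> 2 * sqrt (real (s\<^sup>2))"
    "map_poly real_of_int h = (\<Prod>i<Suc g. [:real (s\<^sup>2), - c i, 1:])"
    using assms(1) unfolding weil_poly_iff_real_factors by blast
  have "s\<^sup>2 > 0" using assms(3) by simp
  from assms(4) obtain i where i: "i < Suc g" "c i = 2 * real s \<or> c i = - 2 * real s"
    unfolding c(2) poly_factors_eq_0_iff[OF \<open>s\<^sup>2 > 0\<close> c(1)] by auto
  then obtain e :: int where e: "e = 1 \<or> e = -1" "c i = 2 * (of_int e * real s)"
    by (metis mult_1 mult_minus_left mult_minus_right of_int_1 of_int_minus)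
  then have e2: "real (s\<^sup>2) = (of_int e * real s)\<^sup>2" by auto
  obtain c' where c': "(\<Prod>j<Suc g. [:real (s\<^sup>2), - c j, 1:]) =
      [:real (s\<^sup>2), - c i, 1:] * (\<Prod>j<g. [:real (s\<^sup>2), - c' j, 1:])"
    "\<forall>j<g. \<exists>k<Suc g. c' j = c k"
    using prod_remove_index[OF i(1), of "\<lambda>d. [:real (s\<^sup>2), - d, 1:]" c] by blast
  let ?m = "[:- (e * int s), 1:]\<^sup>2"
  have "map_poly real_of_int ?m = [:real (s\<^sup>2), - c i, 1:]"
    unfolding e2 e(2) real_factors_square by (simp add: map_poly_of_int_power map_poly_pCons)
  with c(2) c'(1) have "map_poly real_of_int h = map_poly of_int ?m * (\<Prod>j<g. [:real (s\<^sup>2), - c' j, 1:])"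
    by simp
  moreover have "lead_coeff ?m = 1" by (simp add: lead_coeff_power)
  ultimately obtain h0 where h0: "h = ?m * h0" "map_poly real_of_int h0 = (\<Prod>j<g. [:real (s\<^sup>2), - c' j, 1:])"
    using monic_int_poly_division by blast
  moreover have "\<forall>j<g. \<bar>c' j\<bar> \<le> 2 * sqrt (real (s\<^sup>2))" using c(1) c'(2) by metis
  ultimately have "weil_poly (s\<^sup>2) g h0"
    unfolding weil_poly_iff_real_factors using assms(2) by (intro conjI exI[of _ c'])
  then show ?thesis by (rule that[OF e(1) _ h0(1)])
qed

text \<open>The two real roots come from different indices, since their \<open>c\<close> values are
  nonzero and opposite. Each quadratic alone may fail to be integral, so their product is divided
  out in one go.\<close>

lemma weil_poly_fourth_factorE:
  assumes "weil_poly q (Suc (Suc g)) h" "g > 0" "q > 0"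
    and "poly (map_poly real_of_int h) (sqrt (real q)) = 0"
    and "poly (map_poly real_of_int h) (- sqrt (real q)) = 0"
  obtains h0 where "weil_poly q g h0" "h = [:- int q, 0, 1:]\<^sup>2 * h0"
proof -
  let ?S = "sqrt (real q)" and ?f = "\<lambda>d. [:real q, - d, 1:]"
  obtain c where c: "\<forall>i<Suc (Suc g). \<bar>c i\<bar> \<le> 2 * ?S"
    "map_poly real_of_int h = (\<Prod>i<Suc (Suc g). ?f (c i))"
    using assms(1) unfolding weil_poly_iff_real_factors by blast
  have S: "?S > 0" using assms(3) by simp
  from assms(4) obtain i where i: "i < Suc (Suc g)" "c i = 2 * ?S"
    unfolding c(2) poly_factors_eq_0_iff[OF assms(3) c(1)] using S by auto
  from assms(5) obtain j where j: "j < Suc (Suc g)" "c j = - 2 * ?S"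
    unfolding c(2) poly_factors_eq_0_iff[OF assms(3) c(1)] using S by auto
  have "j \<noteq> i"
  proof
    assume "j = i"
    with i(2) j(2) S show False by simp
  qed
  obtain c' where c': "(\<Prod>j<Suc (Suc g). ?f (c j)) = ?f (c i) * (\<Prod>j<Suc g. ?f (c' j))"
    "\<forall>j<Suc g. \<exists>k<Suc (Suc g). c' j = c k"
    "\<forall>k<Suc (Suc g). k \<noteq> i \<longrightarrow> (\<exists>j<Suc g. c' j = c k)"
    using prod_remove_index[OF i(1), of ?f c] by blast
  obtain j' where j': "j' < Suc g" "c' j' = c j" using c'(3) j(1) \<open>j \<noteq> i\<close> by blast
  obtain c'' where c'': "(\<Prod>j<Suc g. ?f (c' j)) = ?f (c' j') * (\<Prod>j<g. ?f (c'' j))"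
    "\<forall>j<g. \<exists>k<Suc g. c'' j = c' k"
    using prod_remove_index[OF j'(1), of ?f c'] by blast
  let ?m = "[:- int q, 0, 1:]\<^sup>2"
  have "map_poly real_of_int h = (?f (c i) * ?f (c' j')) * (\<Prod>j<g. ?f (c'' j))"
    unfolding c(2) c'(1) c''(1) by (simp only: mult.assoc)
  also have "?f (c i) * ?f (c' j') = map_poly real_of_int ?m"
    unfolding j'(2) i(2) j(2) real_factors_fourth by (simp add: map_poly_of_int_power map_poly_pCons)
  finally have "map_poly real_of_int h = map_poly of_int ?m * (\<Prod>j<g. ?f (c'' j))" .
  moreover have "lead_coeff ?m = 1" by (simp add: lead_coeff_power)
  ultimately obtain h0 where h0: "h = ?m * h0" "map_poly real_of_int h0 = (\<Prod>j<g. ?f (c'' j))"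
    using monic_int_poly_division by blast
  moreover have "\<forall>j<g. \<bar>c'' j\<bar> \<le> 2 * ?S" using c(1) c'(2) c''(2) by metis
  ultimately have "weil_poly q g h0"
    unfolding weil_poly_iff_real_factors using assms(2) by (intro conjI exI[of _ c''])
  then show ?thesis by (rule that[OF _ h0(1)])
qed

text \<open>A real root is \<open>sqrt q\<close> or \<open>- sqrt q\<close> and comes from a
  quadratic that is a perfect square. For square \<open>q\<close> this quadratic is integral;
  otherwise conjugation supplies the opposite root too.\<close>

lemma weil_hpoly_real_root_iff:
  fixes q a1 a2 a3 a4 a5
  defines "h \<equiv> hpoly q a1 a2 a3 a4 a5"
  assumes "q > 0"
  shows "weil_poly q 5 h \<and> (\<exists>z::real. poly (map_poly of_int h) z = 0) \<longleftrightarrow>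
    (\<exists>(s0::nat) h0. q = s0 ^ 2 \<and> weil_poly q 4 h0 \<and>
        (h = [:int s0, 1:] ^ 2 * h0 \<or> h = [:- int s0, 1:] ^ 2 * h0)) \<or>
    \<not> (\<exists>s0::nat. q = s0 ^ 2) \<and> (\<exists>h0. weil_poly q 3 h0 \<and> h = [:- int q, 0, 1:] ^ 2 * h0)"
    (is "?L \<longleftrightarrow> ?I \<or> ?II")
proof (intro iffI)
  have n: "Suc 4 = (5::nat)" "Suc (Suc 3) = (5::nat)" by simp_all
  assume L: ?L
  then obtain z :: real where weil: "weil_poly q 5 h" and z: "poly (map_poly of_int h) z = 0" by blast
  show "?I \<or> ?II"
  proof (cases "\<exists>s0::nat. q = s0 ^ 2")
    case True
    then obtain s where s: "q = s\<^sup>2" by blast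
    have "s > 0" using \<open>q > 0\<close> s by (cases s) auto
    obtain e h0 where e: "e = 1 \<or> e = -1" "weil_poly q 4 h0" "h = [:- (e * int s), 1:]\<^sup>2 * h0"
      using weil_poly_square_factorE[of s 4 h z] weil z \<open>s > 0\<close> unfolding s n by auto
    then show ?thesis using s by auto
  next
    case False
    obtain c where c: "\<forall>i<5. \<bar>c i\<bar> \<le> 2 * sqrt (real q)"
      "map_poly real_of_int h = (\<Prod>i<5::nat. [:real q, - c i, 1:])"
      using weil unfolding weil_poly_iff_real_factors by blast
    have "z = sqrt (real q) \<or> z = - sqrt (real q)"
      using z unfolding c(2) poly_factors_eq_0_iff[OF \<open>q > 0\<close> c(1)] by auto
    then have "poly (map_poly real_of_int h) (sqrt (real q)) = 0 \<and>
        poly (map_poly real_of_int h) (- sqrt (real q)) = 0"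
      using hpoly_root_neg_sqrt[OF False, of 1 a1 a2 a3 a4 a5]
        hpoly_root_neg_sqrt[OF False, of "-1" a1 a2 a3 a4 a5] z unfolding h_def by auto
    then obtain h0 where "weil_poly q 3 h0" "h = [:- int q, 0, 1:]\<^sup>2 * h0"
      using weil_poly_fourth_factorE[of q 3 h] weil \<open>q > 0\<close> unfolding n by auto
    with False show ?thesis by blast
  qed
next
  have n: "Suc 4 = (5::nat)" "Suc (Suc 3) = (5::nat)" by simp_all
  assume "?I \<or> ?II"
  then show ?L
  proof (elim disjE)
    assume ?I
    then obtain s h0 where s: "q = s\<^sup>2" "weil_poly q 4 h0"
      "h = [:int s, 1:] ^ 2 * h0 \<or> h = [:- int s, 1:] ^ 2 * h0" by blast
    then have "h = [:- (- 1 * int s), 1:]\<^sup>2 * h0 \<or> h = [:- (1 * int s), 1:]\<^sup>2 * h0" by simp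
    then obtain e where e: "e = 1 \<or> e = -1" "h = [:- (e * int s), 1:]\<^sup>2 * h0" by blast
    have "s > 0" using \<open>q > 0\<close> s by (cases s) auto
    show ?L
      using weil_poly_square_factor[of s 4 h0 e] s(1,2) e \<open>s > 0\<close> unfolding n by blast
  next
    assume ?II
    then obtain h0 where "weil_poly q 3 h0" "h = [:- int q, 0, 1:] ^ 2 * h0" by blast
    then show ?L using weil_poly_fourth_factor[of q 3 h0] unfolding n by blast
  qed
qed

section \<open>From radical formulas to sorted real root lists\<close>

lemma prod_list_map_poly_of_real:
  "(\<Prod>x\<leftarrow>xs. [:- complex_of_real x, 1:]) = map_poly complex_of_real (\<Prod>x\<leftarrow>xs. [:- x, 1:])"
  by (induction xs) (simp_all add: map_poly_mult_hom map_poly_pCons del: mult_pCons_left mult_pCons_right)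

lemma real_factors_of_complex:
  assumes "map_poly complex_of_real p = (\<Prod>x\<leftarrow>xs. [:- x, 1:])" "\<forall>x\<in>set xs. x \<in> \<real>"
  shows "p = (\<Prod>x\<leftarrow>map Re xs. [:- x, 1:])"
proof -
  have "map (\<lambda>x. complex_of_real (Re x)) xs = xs"
    using assms(2) by (induction xs) auto
  with assms(1) have "map_poly complex_of_real p =
      (\<Prod>x\<leftarrow>map (\<lambda>x. complex_of_real (Re x)) xs. [:- x, 1:])" by simp
  also have "\<dots> = map_poly complex_of_real (\<Prod>x\<leftarrow>map Re xs. [:- x, 1:])"
    unfolding prod_list_map_poly_of_real[symmetric] by (simp add: o_def)
  finally show ?thesis unfolding map_poly_of_real_eq_iff .
qed

text \<open>Each \<open>theta k\<close> is \<open>- u2 b^2 - 3 u3 b\<close> at a Cardano root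
  \<open>b\<close> of the cubic, which is exactly the threshold for \<open>u4\<close> in the quartic
  criterion.\<close>

lemma cardano_thetas:
  fixes zt sd om :: complex and u2 u3 u4 :: real
  defines "theta \<equiv> (\<lambda>(k::nat). - (zt ^ k * om * (9 * complex_of_real u3 / 2 + 3 * sd / 2))
                   - (inverse zt) ^ k * cnj om * (9 * complex_of_real u3 / 2 - 3 * sd / 2)
                   + complex_of_real (2 * u2 ^ 2 / 3))"
  defines "thetas \<equiv> sort (map (\<lambda>k. Re (theta k)) [0, 1, 2])"
  assumes zt: "zt ^ 3 = 1" "zt \<noteq> 1"
    and sd: "sd ^ 2 = complex_of_real (u3 ^ 2 + 4 / 27 * u2 ^ 3)"
    and om: "om ^ 3 = (- complex_of_real u3 + sd) / 2"
    and disc: "u3 ^ 2 + 4 / 27 * u2 ^ 3 \<le> 0"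
  shows "theta k \<in> \<real>"
    "real_rooted [:u4, 4 * u3, 2 * u2, 0, 1:] \<longleftrightarrow> thetas ! 0 \<le> u4 \<and> u4 \<le> thetas ! 1"
proof -
  define \<beta> where "\<beta> k = zt ^ k * om + inverse zt ^ k * cnj om" for k
  note c = cardano_real_roots[OF zt sd om disc, folded \<beta>_def]
  have real: "\<beta> k \<in> \<real>" for k by (rule c(1))
  have theta: "theta k = - complex_of_real u2 * (\<beta> k)\<^sup>2 - 3 * complex_of_real u3 * \<beta> k" for k
    unfolding theta_def by (rule c(3))
  show "theta k \<in> \<real>" for k unfolding theta using real[of k] by simp
  have Re_theta: "Re (theta k) = - u2 * (Re (\<beta> k))\<^sup>2 - 3 * u3 * Re (\<beta> k)" for k
  proof -
    obtain b where b: "\<beta> k = of_real b" using real[of k] by (rule Reals_cases)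
    show ?thesis unfolding theta b of_real_power[symmetric] by simp
  qed
  let ?xs = "map (\<lambda>k. Re (\<beta> k)) [0, 1, 2]"
  have "map_poly complex_of_real [:u3, u2, 0, 1:] = (\<Prod>x\<leftarrow>map \<beta> [0, 1, 2]. [:- x, 1:])"
    unfolding c(2)
    by (simp add: numeral_3_eq_3 numeral_2_eq_2 mult_ac del: mult_pCons_left mult_pCons_right)
  from real_factors_of_complex[OF this] real
  have "[:u3, u2, 0, 1:] = (\<Prod>x\<leftarrow>?xs. [:- x, 1:])" unfolding map_map o_def by auto
  from real_rooted_quartic_iff[OF this, of u4]
  have "real_rooted [:u4, 4 * u3, 2 * u2, 0, 1:] \<longleftrightarrow>
      sort (map (\<lambda>b. - u2 * b\<^sup>2 - 3 * u3 * b) ?xs) ! 0 \<le> u4 \<and>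
      u4 \<le> sort (map (\<lambda>b. - u2 * b\<^sup>2 - 3 * u3 * b) ?xs) ! 1" by simp
  also have "map (\<lambda>b. - u2 * b\<^sup>2 - 3 * u3 * b) ?xs = map (\<lambda>k. Re (theta k)) [0, 1, 2]"
    unfolding Re_theta by simp
  finally show "real_rooted [:u4, 4 * u3, 2 * u2, 0, 1:] \<longleftrightarrow> thetas ! 0 \<le> u4 \<and> u4 \<le> thetas ! 1"
    unfolding thetas_def .
qed

text \<open>The \<open>x i1 i2\<close> are all the complex roots of the quartic, so
  \<open>rr\<close> makes them real; sorted, they are the critical points of the quintic.\<close>

lemma ferrari_gammas:
  fixes u2 u3 u4 e :: real and r w C sq2y :: complex and t s :: "int \<Rightarrow> complex"
  defines "v2 \<equiv> - (u2 ^ 2) / 3 - u4"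
    and "v3 \<equiv> 2 * u2 * u4 / 3 - 2 * u2 ^ 3 / 27 - 2 * u3 ^ 2"
  defines "y \<equiv> C - complex_of_real v2 / (3 * C) - 2 * complex_of_real u2 / 3"
  defines "x \<equiv> (\<lambda>i1 i2 :: int. if u3 = 0 then of_int i1 * t i2
                 else (of_int i1 * sq2y + of_int i2 * s i1) / 2)"
  defines "gammas \<equiv> sort (map (\<lambda>(i, j). Re (x i j)) [(1, 1), (1, -1), (-1, 1), (-1, -1)])"
  defines "H \<equiv> (\<lambda>z::real. - (z ^ 5) - 10 / 3 * u2 * z ^ 3 - 10 * u3 * z ^ 2 - 5 * u4 * z)"
  assumes r: "r\<^sup>2 = complex_of_real (u2 ^ 2 - u4)"
    and t: "\<forall>i\<in>{1, -1}. (t i)\<^sup>2 = - complex_of_real u2 + of_int i * r"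
    and w: "w\<^sup>2 = complex_of_real (v3 ^ 2 + 4 / 27 * v2 ^ 3)"
    and C: "if v2 = 0 then C ^ 3 = - complex_of_real v3
            else C ^ 3 = (- complex_of_real v3 + w) / 2"
    and sq2y: "sq2y\<^sup>2 = 2 * y"
    and s: "\<forall>i\<in>{1, -1}. (s i)\<^sup>2 = - 4 * complex_of_real u2 - 2 * y
                               - of_int i * 8 * complex_of_real u3 / sq2y"
    and rr: "real_rooted [:u4, 4 * u3, 2 * u2, 0, 1:]"
  shows "\<forall>i1\<in>{1, -1}. \<forall>i2\<in>{1, -1}. x i1 i2 \<in> \<real>"
    "real_rooted [:e, 5 * u4, 10 * u3, 10 / 3 * u2, 0, 1:] \<longleftrightarrow>
      max (H (gammas ! 0)) (H (gammas ! 2)) \<le> e \<and> e \<le> min (H (gammas ! 1)) (H (gammas ! 3))"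
proof -
  let ?P = "[:u4, 4 * u3, 2 * u2, 0, 1:]"
  let ?ij = "[(1, 1), (1, -1), (-1, 1), (-1, -1)] :: (int \<times> int) list"
  define xs where "xs = map (\<lambda>(i, j). x i j) ?ij"
  have "[:of_real u4, 4 * of_real u3, 2 * of_real u2, 0, 1:] = (\<Prod>x\<leftarrow>xs. [:- x, 1:])"
  proof (cases "u3 = 0")
    case True
    then have "xs = [t 1, t (-1), - t 1, - t (-1)]" by (simp add: xs_def x_def)
    moreover have "[:of_real u4, 0, 2 * of_real u2, 0, 1:] =
        (\<Prod>x\<leftarrow>[t 1, t (-1), - t 1, - t (-1)]. [:- x, 1:])"
      using r t by (intro ferrari_biquadratic[of r]) simp_all
    ultimately show ?thesis using True by (simp only: of_real_0 mult_zero_right)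
  next
    case False
    then have xs': "xs = [(sq2y + s 1) / 2, (sq2y - s 1) / 2, (- sq2y + s (-1)) / 2, (- sq2y - s (-1)) / 2]"
      by (simp add: xs_def x_def)
    \<comment> \<open>The shift \<open>y = Y - 2 u2 / 3\<close> removes the quadratic term of
      Ferrari's resolvent; \<open>v2\<close> and \<open>v3\<close> are the coefficients that
      remain.\<close>
    define Y where "Y = C - complex_of_real v2 / (3 * C)"
    have "Y ^ 3 + of_real v2 * Y + of_real v3 = 0"
      unfolding Y_def using C w by (intro cardano_resolvent_root[of _ C _ w]) simp_all
    moreover have y: "y = Y - 2 * of_real u2 / 3" by (simp add: y_def Y_def)
    have "y ^ 3 + 2 * of_real u2 * y\<^sup>2 + ((of_real u2)\<^sup>2 - of_real u4) * y - 2 * (of_real u3)\<^sup>2 =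
        Y ^ 3 + of_real v2 * Y + of_real v3"
      unfolding y v2_def v3_def by (simp add: field_simps power2_eq_square power3_eq_cube)
    ultimately have "y ^ 3 + 2 * of_real u2 * y\<^sup>2 + ((of_real u2)\<^sup>2 - of_real u4) * y - 2 * (of_real u3)\<^sup>2 = 0"
      by simp
    then show ?thesis
      unfolding xs' using s sq2y False by (intro ferrari_quartic[of y]) simp_all
  qed
  then have xs: "map_poly complex_of_real ?P = (\<Prod>x\<leftarrow>xs. [:- x, 1:])"
    by (simp add: map_poly_pCons del: mult_pCons_left mult_pCons_right)
  have root: "poly (\<Prod>x\<leftarrow>ys. [:- x, 1:]) z = 0" if "z \<in> set ys" for ys and z :: complex
    using that by (induction ys) auto
  have "x' \<in> \<real>" if "x' \<in> set xs" for x'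
  proof -
    have "poly (map_poly complex_of_real ?P) x' = 0"
      unfolding xs by (rule root[OF that])
    then show ?thesis using rr real_rooted_iff_complex_roots[of ?P] by auto
  qed
  then have real: "\<forall>x'\<in>set xs. x' \<in> \<real>" by blast
  then show "\<forall>i1\<in>{1, -1}. \<forall>i2\<in>{1, -1}. x i1 i2 \<in> \<real>" by (simp add: xs_def)
  have "?P = (\<Prod>x\<leftarrow>map Re xs. [:- x, 1:])"
    using xs real by (rule real_factors_of_complex)
  from real_rooted_quintic_iff[OF this, of e]
  have "real_rooted [:e, 5 * u4, 10 * u3, 10 / 3 * u2, 0, 1:] \<longleftrightarrow>
      max (H (sort (map Re xs) ! 0)) (H (sort (map Re xs) ! 2)) \<le> e \<and>
      e \<le> min (H (sort (map Re xs) ! 1)) (H (sort (map Re xs) ! 3))"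
    unfolding H_def by (simp add: xs_def)
  also have "sort (map Re xs) = gammas"
    unfolding gammas_def xs_def by simp
  finally show "real_rooted [:e, 5 * u4, 10 * u3, 10 / 3 * u2, 0, 1:] \<longleftrightarrow>
      max (H (gammas ! 0)) (H (gammas ! 2)) \<le> e \<and> e \<le> min (H (gammas ! 1)) (H (gammas ! 3))" .
qed

section \<open>Descent along the derivatives, and conditions (b) and (c)\<close>

lemma real_rooted_quintic_imp_quartic:
  assumes "real_rooted [:e, 5 * u4, 10 * u3, 10 / 3 * u2, 0, 1:]"
  shows "real_rooted [:u4, 4 * u3, 2 * u2, 0, 1:]"
proof -
  have "real_rooted (pderiv [:e, 5 * u4, 10 * u3, 10 / 3 * u2, 0, 1:])"
    using assms by (rule real_rooted_pderiv) simp
  also have "pderiv [:e, 5 * u4, 10 * u3, 10 / 3 * u2, 0, 1:] = smult 5 [:u4, 4 * u3, 2 * u2, 0, 1:]"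
    by (simp add: pderiv_pCons)
  finally show ?thesis by (simp add: real_rooted_def del: smult_pCons)
qed

lemma real_rooted_quartic_imp_discriminant:
  assumes "real_rooted [:u4, 4 * u3, 2 * u2, 0, 1:]"
  shows "u3 ^ 2 + 4 / 27 * u2 ^ 3 \<le> 0"
proof (rule depressed_cubic_discriminant)
  have "real_rooted (pderiv [:u4, 4 * u3, 2 * u2, 0, 1:])"
    using assms by (rule real_rooted_pderiv) simp
  also have "pderiv [:u4, 4 * u3, 2 * u2, 0, 1:] = smult 4 [:u3, u2, 0, 1:]"
    by (simp add: pderiv_pCons)
  finally show "real_rooted [:u3, u2, 0, 1:]" by (simp add: real_rooted_def del: smult_pCons)
qed

text \<open>With \<open>D = 4 a1^2 + 50 q - 10 a2\<close>, condition (b) is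
  \<open>D \<ge> 0\<close>, and squaring (c) gives
  \<open>100 u3^2 \<le> D^3 / 2500 = - 400/27 u2^3\<close>. For negative \<open>D\<close>,
  \<open>u2\<close> is positive and the discriminant bound fails.\<close>

lemma discriminant_iff_bounds:
  fixes u2 u3 D :: real
  assumes D: "D = - 100 / 3 * u2"
  shows "u3 ^ 2 + 4 / 27 * u2 ^ 3 \<le> 0 \<longleftrightarrow> 0 \<le> D \<and> \<bar>10 * u3\<bar> \<le> 1 / 50 * D powr (3 / 2)"
proof (cases "D \<ge> 0")
  case True
  have "(D powr (3 / 2))\<^sup>2 = D ^ 3"
  proof (cases "D = 0")
    case False
    with True have "(D powr (3 / 2))\<^sup>2 = D powr 3" by (simp add: power2_eq_square flip: powr_add)
    with True False show ?thesis by (simp add: powr_numeral)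
  qed simp
  then have sq: "(1 / 50 * D powr (3 / 2))\<^sup>2 = - 400 / 27 * u2 ^ 3"
    by (simp add: power_mult_distrib power_divide D)
  have "\<bar>10 * u3\<bar> \<le> 1 / 50 * D powr (3 / 2) \<longleftrightarrow> (10 * u3)\<^sup>2 \<le> (1 / 50 * D powr (3 / 2))\<^sup>2"
    using abs_le_square_iff[of "10 * u3" "1 / 50 * D powr (3 / 2)"] by simp
  moreover have "u3 ^ 2 + 4 / 27 * u2 ^ 3 \<le> 0 \<longleftrightarrow> (10 * u3)\<^sup>2 \<le> - 400 / 27 * u2 ^ 3"
    unfolding power_mult_distrib by (intro iffI; simp)
  ultimately show ?thesis unfolding sq using True by blast
next
  case False
  then have "u2 ^ 3 > 0" using D by simp
  then have "u3 ^ 2 + 4 / 27 * u2 ^ 3 > 0" using zero_le_power2[of u3] by linarith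
  with False show ?thesis by simp
qed

text \<open>A condition with an absolute value packs together one Taylor coefficient from each end
  point.\<close>

lemma abs_diff_le_iff_bounds:
  fixes u v w :: real
  shows "\<bar>u\<bar> - v \<le> w \<longleftrightarrow> 0 \<le> w + u + v \<and> 0 \<le> w - u + v"
    "0 \<le> w + u + v \<and> 0 \<le> w - u + v \<Longrightarrow> \<bar>u\<bar> - v = w \<longleftrightarrow> w + u + v = 0 \<or> w - u + v = 0"
  by auto

text \<open>Substituting \<open>x - a1 / 5\<close> removes the \<open>x^4\<close> term.
  \<open>A\<close> collects everything in the new constant term apart from
  \<open>a5\<close>.\<close>

lemma trace_poly_depressed:
  fixes q a1 a2 a3 a4 a5
  defines "Q \<equiv> real q"
    and "A1 \<equiv> real_of_int a1" and "A2 \<equiv> real_of_int a2" and "A3 \<equiv> real_of_int a3"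
    and "A4 \<equiv> real_of_int a4" and "A5 \<equiv> real_of_int a5"
  defines "u2 \<equiv> - 3 * A1 ^ 2 / 25 + 3 * A2 / 10 - 3 * Q / 2"
    and "u3 \<equiv> 2 * A1 ^ 3 / 125 - 3 * A1 * A2 / 50 - Q * A1 / 10 + A3 / 10"
    and "u4 \<equiv> - 3 * A1 ^ 4 / 625 + 3 * A1 ^ 2 * A2 / 125 + Q * A1 ^ 2 / 5
              - 2 * A1 * A3 / 25 - 3 * Q * A2 / 5 + A4 / 5 + Q ^ 2"
    and "A \<equiv> - 4 * A1 ^ 5 / 3125 + A1 ^ 3 * (A2 + 15 * Q) / 125 - A1 ^ 2 * A3 / 25
              - A1 * (3 * A2 * Q - A4 + 5 * Q ^ 2) / 5 + 2 * Q * A3"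
  shows "pcompose (trace_poly q a1 a2 a3 a4 a5) [:- A1 / 5, 1:] =
    [:A5 - A, 5 * u4, 10 * u3, 10 / 3 * u2, 0, 1:]"
proof -
  have "pcompose (trace_poly q a1 a2 a3 a4 a5) [:- A1 / 5, 1:] =
      pcompose [:A5 - 2 * Q * A3 + 2 * Q\<^sup>2 * A1, A4 - 3 * Q * A2 + 5 * Q\<^sup>2,
        A3 - 4 * Q * A1, A2 - 5 * Q, A1, 1:] [:- A1 / 5, 1:]"
    by (simp add: trace_poly_def Q_def A1_def A2_def A3_def A4_def A5_def)
  also have "\<dots> = [:A5 - A, 5 * u4, 10 * u3, 10 / 3 * u2, 0, 1:]"
    unfolding u2_def u3_def u4_def A_def
    by (simp add: pcompose_pCons field_simps eval_nat_numeral)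
  finally show ?thesis .
qed

text \<open>Every radical is a variable constrained by its defining equation, so the conclusion
  holds for all choices of roots. The functions \<open>t\<close> and \<open>s\<close> supply one
  square root for each sign, and "exactly one case" is a disjunction without the
  conjunction.\<close>

theorem theoremC:
  fixes q :: nat and a1 a2 a3 a4 a5 :: int
    and zt sd om r w C sq2y :: complex
    and t s :: "int \<Rightarrow> complex"
  defines "h \<equiv> hpoly q a1 a2 a3 a4 a5"
    and "Q \<equiv> real q"
    and "A1 \<equiv> real_of_int a1" and "A2 \<equiv> real_of_int a2" and "A3 \<equiv> real_of_int a3"
    and "A4 \<equiv> real_of_int a4" and "A5 \<equiv> real_of_int a5"
  defines "u2 \<equiv> - 3 * A1 ^ 2 / 25 + 3 * A2 / 10 - 3 * Q / 2"
    and "u3 \<equiv> 2 * A1 ^ 3 / 125 - 3 * A1 * A2 / 50 - Q * A1 / 10 + A3 / 10"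
    and "u4 \<equiv> - 3 * A1 ^ 4 / 625 + 3 * A1 ^ 2 * A2 / 125 + Q * A1 ^ 2 / 5
              - 2 * A1 * A3 / 25 - 3 * Q * A2 / 5 + A4 / 5 + Q ^ 2"
  defines "Delta \<equiv> u3 ^ 2 + 4 / 27 * u2 ^ 3"
  defines "theta \<equiv> (\<lambda>(k::nat). - (zt ^ k * om * (9 * complex_of_real u3 / 2 + 3 * sd / 2))
                   - (inverse zt) ^ k * cnj om * (9 * complex_of_real u3 / 2 - 3 * sd / 2)
                   + complex_of_real (2 * u2 ^ 2 / 3))"
  defines "thetas \<equiv> sort (map (\<lambda>k. Re (theta k)) [0, 1, 2])"
  defines "v2 \<equiv> - (u2 ^ 2) / 3 - u4"
    and "v3 \<equiv> 2 * u2 * u4 / 3 - 2 * u2 ^ 3 / 27 - 2 * u3 ^ 2"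
  defines "y \<equiv> C - complex_of_real v2 / (3 * C) - 2 * complex_of_real u2 / 3"
  defines "x \<equiv> (\<lambda>i1 i2 :: int. if u3 = 0 then of_int i1 * t i2
                 else (of_int i1 * sq2y + of_int i2 * s i1) / 2)"
  defines "gammas \<equiv> sort (map (\<lambda>(i, j). Re (x i j)) [(1, 1), (1, -1), (-1, 1), (-1, -1)])"
  defines "H \<equiv> (\<lambda>z::real. - (z ^ 5) - 10 / 3 * u2 * z ^ 3 - 10 * u3 * z ^ 2 - 5 * u4 * z)"
  defines "Lam1 \<equiv> max (H (gammas ! 0)) (H (gammas ! 2))"
    and "Lam2 \<equiv> min (H (gammas ! 1)) (H (gammas ! 3))"
  defines "A \<equiv> - 4 * A1 ^ 5 / 3125 + A1 ^ 3 * (A2 + 15 * Q) / 125 - A1 ^ 2 * A3 / 25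
              - A1 * (3 * A2 * Q - A4 + 5 * Q ^ 2) / 5 + 2 * Q * A3"
  defines "ca \<equiv> \<bar>A1\<bar> \<le> 10 * sqrt Q"
    and "cbs \<equiv> 8 * sqrt Q * \<bar>A1\<bar> - 35 * Q \<le> A2"
    and "cb \<equiv> A2 \<le> 2 / 5 * A1 ^ 2 + 5 * Q"
    and "cc \<equiv> - 4 / 25 * A1 ^ 3 + 3 / 5 * A1 * A2 + Q * A1
                 - 1 / 50 * (4 * A1 ^ 2 + 50 * Q - 10 * A2) powr (3 / 2) \<le> A3 \<and>
              A3 \<le> - 4 / 25 * A1 ^ 3 + 3 / 5 * A1 * A2 + Q * A1
                 + 1 / 50 * (4 * A1 ^ 2 + 50 * Q - 10 * A2) powr (3 / 2)"
    and "cd \<equiv> - 6 * sqrt Q * A2 - 20 * Q * A1 - 50 * Q * sqrt Q \<le> A3 \<and>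
              A3 \<le> 6 * sqrt Q * A2 - 20 * Q * A1 + 50 * Q * sqrt Q"
    and "ce \<equiv> 3 * A1 ^ 4 / 125 - 3 * A1 ^ 2 * A2 / 25 - Q * A1 ^ 2 + 2 * A1 * A3 / 5
                 + 3 * Q * A2 - 5 * Q ^ 2 + 5 * (thetas ! 0) \<le> A4 \<and>
              A4 \<le> 3 * A1 ^ 4 / 125 - 3 * A1 ^ 2 * A2 / 25 - Q * A1 ^ 2 + 2 * A1 * A3 / 5
                 + 3 * Q * A2 - 5 * Q ^ 2 + 5 * (thetas ! 1)"
    and "cf \<equiv> 4 * sqrt Q * \<bar>4 * Q * A1 + A3\<bar> - 9 * Q * A2 - 25 * Q ^ 2 \<le> A4"
    and "cg \<equiv> - 2 * sqrt Q * A4 - 2 * Q * A3 - 2 * Q * sqrt Q * A2 - 2 * Q ^ 2 * A1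
                 - 2 * Q ^ 2 * sqrt Q \<le> A5 \<and>
              A5 \<le> 2 * sqrt Q * A4 - 2 * Q * A3 + 2 * Q * sqrt Q * A2 - 2 * Q ^ 2 * A1
                 + 2 * Q ^ 2 * sqrt Q"
    and "ch \<equiv> Lam1 + A \<le> A5 \<and> A5 \<le> Lam2 + A"
  defines "eq \<equiv> \<bar>A1\<bar> = 10 * sqrt Q
              \<or> 8 * sqrt Q * \<bar>A1\<bar> - 35 * Q = A2
              \<or> - 6 * sqrt Q * A2 - 20 * Q * A1 - 50 * Q * sqrt Q = A3
              \<or> A3 = 6 * sqrt Q * A2 - 20 * Q * A1 + 50 * Q * sqrt Q
              \<or> 4 * sqrt Q * \<bar>4 * Q * A1 + A3\<bar> - 9 * Q * A2 - 25 * Q ^ 2 = A4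
              \<or> - 2 * sqrt Q * A4 - 2 * Q * A3 - 2 * Q * sqrt Q * A2 - 2 * Q ^ 2 * A1
                 - 2 * Q ^ 2 * sqrt Q = A5
              \<or> A5 = 2 * sqrt Q * A4 - 2 * Q * A3 + 2 * Q * sqrt Q * A2 - 2 * Q ^ 2 * A1
                 + 2 * Q ^ 2 * sqrt Q"
  defines "caseI \<equiv> (\<exists>(s0::nat) h0. q = s0 ^ 2 \<and> weil_poly q 4 h0 \<and>
                      (h = [:int s0, 1:] ^ 2 * h0 \<or> h = [:- int s0, 1:] ^ 2 * h0))"
    and "caseII \<equiv> (\<not> (\<exists>s0::nat. q = s0 ^ 2) \<and>
                      (\<exists>h0. weil_poly q 3 h0 \<and> h = [:- int q, 0, 1:] ^ 2 * h0))"
  assumes q: "prime_power q"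
    and zt: "zt ^ 3 = 1" "zt \<noteq> 1"
    and sd: "sd ^ 2 = complex_of_real Delta"
    and omega: "om ^ 3 = (- complex_of_real u3 + sd) / 2"
    and r: "is_sqrt (complex_of_real (u2 ^ 2 - u4)) r"
    and t: "\<forall>i\<in>{1, -1}. is_sqrt (- complex_of_real u2 + of_int i * r) (t i)"
    and w: "is_sqrt (complex_of_real (v3 ^ 2 + 4 / 27 * v2 ^ 3)) w"
    and C: "if v2 = 0 then C ^ 3 = - complex_of_real v3
            else C ^ 3 = (- complex_of_real v3 + w) / 2"
    and sq2y: "is_sqrt (2 * y) sq2y"
    and s: "\<forall>i\<in>{1, -1}. is_sqrt (- 4 * complex_of_real u2 - 2 * y
                               - of_int i * 8 * complex_of_real u3 / sq2y) (s i)"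
  shows "((weil_poly q 5 h \<or> (ca \<and> cbs \<and> cb \<and> cc \<and> cd)) \<longrightarrow> (\<forall>k<3. theta k \<in> \<real>))
    \<and> ((weil_poly q 5 h \<or> (ca \<and> cbs \<and> cb \<and> cc \<and> cd \<and> ce \<and> cf)) \<longrightarrow>
         (\<forall>i1\<in>{1, -1}. \<forall>i2\<in>{1, -1}. x i1 i2 \<in> \<real>))
    \<and> (weil_poly q 5 h \<longleftrightarrow> ca \<and> cbs \<and> cb \<and> cc \<and> cd \<and> ce \<and> cf \<and> cg \<and> ch)
    \<and> (weil_poly q 5 h \<longrightarrow> ((\<exists>z::real. poly (map_poly of_int h) z = 0) \<longleftrightarrow> eq))
    \<and> ((weil_poly q 5 h \<and> (\<exists>z::real. poly (map_poly of_int h) z = 0)) \<longleftrightarrow>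
         ((caseI \<or> caseII) \<and> \<not> (caseI \<and> caseII)))"
proof -
  have "q > 0" using q by (auto simp: prime_power_def prime_gt_0_nat)
  then have "Q > 0" by (simp add: Q_def)
  define S where "S = sqrt Q"
  have "S > 0" and QS: "Q = S\<^sup>2" using \<open>Q > 0\<close> by (simp_all add: S_def)
  define f where "f = trace_poly q a1 a2 a3 a4 a5"
  define P where "P = [:u4, 4 * u3, 2 * u2, 0, 1:]"
  define F where "F = [:A5 - A, 5 * u4, 10 * u3, 10 / 3 * u2, 0, 1:]"
  have "pcompose f [:- A1 / 5, 1:] = F"
    unfolding f_def F_def u2_def u3_def u4_def A_def Q_def A1_def A2_def A3_def A4_def A5_def
    by (rule trace_poly_depressed)
  then have fF: "real_rooted f \<longleftrightarrow> real_rooted F" by (metis real_rooted_pcompose_shift)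
  have FP: "real_rooted F \<Longrightarrow> real_rooted P"
    unfolding F_def P_def by (rule real_rooted_quintic_imp_quartic)
  have PD: "real_rooted P \<Longrightarrow> Delta \<le> 0"
    unfolding P_def Delta_def by (rule real_rooted_quartic_imp_discriminant)

  define T where "T = set (trace_bounds S A1 A2 A3 A4 A5) \<union> set (trace_bounds S (- A1) A2 (- A3) A4 (- A5))"
  have T: "(\<forall>i<5::nat. \<bar>c i\<bar> \<le> 2 * S) \<longleftrightarrow> (\<forall>t\<in>T. t \<ge> 0)"
    "(\<forall>i<5::nat. \<bar>c i\<bar> \<le> 2 * S) \<Longrightarrow> (\<exists>i<5. c i = 2 * S \<or> c i = - 2 * S) \<longleftrightarrow> (\<exists>t\<in>T. t = 0)"
    if "f = (\<Prod>i<5::nat. [:- c i, 1:])" for c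
    using trace_poly_eq_factors_bounds[OF that[unfolded f_def]]
    unfolding T_def S_def Q_def A1_def A2_def A3_def A4_def A5_def by blast+
  have weil: "weil_poly q 5 h \<longleftrightarrow> (\<exists>c. (\<forall>i<5::nat. \<bar>c i\<bar> \<le> 2 * S) \<and> f = (\<Prod>i<5. [:- c i, 1:]))"
    unfolding h_def f_def S_def Q_def by (rule weil_hpoly_iff_trace_poly_factors) fact
  have "degree f = 5" "lead_coeff f = 1" by (simp_all add: f_def trace_poly_def)
  have "real_rooted f \<longleftrightarrow> (\<exists>c. f = (\<Prod>i<5::nat. [:- c i, 1:]))"
  proof
    assume "real_rooted f"
    from real_rooted_monicE[OF this \<open>degree f = 5\<close> \<open>lead_coeff f = 1\<close>]
    show "\<exists>c. f = (\<Prod>i<5::nat. [:- c i, 1:])" by metis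
  next
    assume "\<exists>c. f = (\<Prod>i<5::nat. [:- c i, 1:])"
    then obtain c where "f = smult 1 (\<Prod>i<5::nat. [:- c i, 1:])" by auto
    then show "real_rooted f" by (rule real_rootedI) simp
  qed
  \<comment> \<open>This separates two independent tasks: real-rootedness of \<open>f\<close>, and
    the location of its roots.\<close>
  with weil T(1) have weil_T: "weil_poly q 5 h \<longleftrightarrow> real_rooted f \<and> (\<forall>t\<in>T. t \<ge> 0)" by blast

  have abs_S: "8 * S * \<bar>A1\<bar> = \<bar>8 * S * A1\<bar>"
    "4 * S * \<bar>4 * S\<^sup>2 * A1 + A3\<bar> = \<bar>4 * S * (4 * S\<^sup>2 * A1 + A3)\<bar>"
    using \<open>S > 0\<close> by (simp_all only: abs_mult abs_numeral abs_of_pos)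
  have m: "A2 + 8 * S * (- A1) + 35 * S\<^sup>2 = A2 - 8 * S * A1 + 35 * S\<^sup>2" by simp
  \<comment> \<open>Hiding these terms behind \<open>V\<close> leaves (f) as a linear statement
    about \<open>V\<close> and one product.\<close>
  define V where "V = A4 + 9 * S\<^sup>2 * A2 + 25 * S ^ 4"
  have V: "4 * S * \<bar>4 * S\<^sup>2 * A1 + A3\<bar> - 9 * S\<^sup>2 * A2 - 25 * (S\<^sup>2)\<^sup>2 - A4
      = \<bar>4 * S * (4 * S\<^sup>2 * A1 + A3)\<bar> - V"
    "A4 + 9 * S\<^sup>2 * A2 + 25 * S ^ 4 + 4 * S * (4 * S\<^sup>2 * (- A1) + - A3) = V - 4 * S * (4 * S\<^sup>2 * A1 + A3)"
    unfolding abs_S V_def by (simp_all add: algebra_simps)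
  have c4: "ca \<longleftrightarrow> 0 \<le> A1 + 10 * S \<and> 0 \<le> - A1 + 10 * S"
    unfolding ca_def S_def[symmetric] by auto
  have c3: "cbs \<longleftrightarrow> 0 \<le> A2 + 8 * S * A1 + 35 * S\<^sup>2 \<and> 0 \<le> A2 + 8 * S * (- A1) + 35 * S\<^sup>2"
    unfolding cbs_def S_def[symmetric] unfolding QS abs_S m by (rule abs_diff_le_iff_bounds)
  have c2: "cd \<longleftrightarrow> 0 \<le> A3 + 20 * S\<^sup>2 * A1 + 6 * S * A2 + 50 * S ^ 3 \<and>
      0 \<le> - A3 + 20 * S\<^sup>2 * (- A1) + 6 * S * A2 + 50 * S ^ 3"
    unfolding cd_def S_def[symmetric] unfolding QS by (auto simp: algebra_simps eval_nat_numeral)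
  have "cf \<longleftrightarrow> 4 * S * \<bar>4 * S\<^sup>2 * A1 + A3\<bar> - 9 * S\<^sup>2 * A2 - 25 * (S\<^sup>2)\<^sup>2 - A4 \<le> 0"
    unfolding cf_def S_def[symmetric] unfolding QS by auto
  then have c1: "cf \<longleftrightarrow> 0 \<le> A4 + 9 * S\<^sup>2 * A2 + 25 * S ^ 4 + 4 * S * (4 * S\<^sup>2 * A1 + A3) \<and>
      0 \<le> A4 + 9 * S\<^sup>2 * A2 + 25 * S ^ 4 + 4 * S * (4 * S\<^sup>2 * (- A1) + - A3)"
    unfolding V unfolding V_def[symmetric] by linarith
  have c0: "cg \<longleftrightarrow> 0 \<le> A5 + 2 * S * A4 + 2 * S\<^sup>2 * A3 + 2 * S ^ 3 * A2 + 2 * S ^ 4 * A1 + 2 * S ^ 5 \<and>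
      0 \<le> - A5 + 2 * S * A4 + 2 * S\<^sup>2 * (- A3) + 2 * S ^ 3 * A2 + 2 * S ^ 4 * (- A1) + 2 * S ^ 5"
    unfolding cg_def S_def[symmetric] unfolding QS by (auto simp: algebra_simps eval_nat_numeral)
  have T_nonneg: "(\<forall>t\<in>T. t \<ge> 0) \<longleftrightarrow> ca \<and> cbs \<and> cd \<and> cf \<and> cg"
    unfolding T_def trace_bounds_def list.set ball_Un c4 c3 c2 c1 c0 by blast
  \<comment> \<open>From \<open>m + u = 0\<close> or \<open>m - u = 0\<close> one may infer
    \<open>\<bar>u\<bar> = m\<close> only for \<open>m \<ge> 0\<close>; nonnegativity of both terms
    provides this.\<close>
  have T_zero: "(\<exists>t\<in>T. t = 0) \<longleftrightarrow> eq" if "\<forall>t\<in>T. t \<ge> 0"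
  proof -
    from that T_nonneg have all: "ca" "cbs" "cf" by blast+
    have z4: "\<bar>A1\<bar> = 10 * S \<longleftrightarrow> A1 + 10 * S = 0 \<or> - A1 + 10 * S = 0"
      using all(1) unfolding c4 by linarith
    have z3: "8 * S * \<bar>A1\<bar> - 35 * S\<^sup>2 = A2 \<longleftrightarrow>
        A2 + 8 * S * A1 + 35 * S\<^sup>2 = 0 \<or> A2 + 8 * S * (- A1) + 35 * S\<^sup>2 = 0"
      using all(2) unfolding c3 abs_S m by (rule abs_diff_le_iff_bounds)
    have z2: "- 6 * S * A2 - 20 * S\<^sup>2 * A1 - 50 * S\<^sup>2 * S = A3 \<longleftrightarrow>
        A3 + 20 * S\<^sup>2 * A1 + 6 * S * A2 + 50 * S ^ 3 = 0"
      "A3 = 6 * S * A2 - 20 * S\<^sup>2 * A1 + 50 * S\<^sup>2 * S \<longleftrightarrow>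
        - A3 + 20 * S\<^sup>2 * (- A1) + 6 * S * A2 + 50 * S ^ 3 = 0"
      by (auto simp: algebra_simps eval_nat_numeral)
    have "4 * S * \<bar>4 * S\<^sup>2 * A1 + A3\<bar> - 9 * S\<^sup>2 * A2 - 25 * (S\<^sup>2)\<^sup>2 = A4 \<longleftrightarrow>
        4 * S * \<bar>4 * S\<^sup>2 * A1 + A3\<bar> - 9 * S\<^sup>2 * A2 - 25 * (S\<^sup>2)\<^sup>2 - A4 = 0" by auto
    then have z1: "4 * S * \<bar>4 * S\<^sup>2 * A1 + A3\<bar> - 9 * S\<^sup>2 * A2 - 25 * (S\<^sup>2)\<^sup>2 = A4 \<longleftrightarrow>
        A4 + 9 * S\<^sup>2 * A2 + 25 * S ^ 4 + 4 * S * (4 * S\<^sup>2 * A1 + A3) = 0 \<or>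
        A4 + 9 * S\<^sup>2 * A2 + 25 * S ^ 4 + 4 * S * (4 * S\<^sup>2 * (- A1) + - A3) = 0"
      using all(3) unfolding c1 unfolding V unfolding V_def[symmetric] by linarith
    have z0: "- 2 * S * A4 - 2 * S\<^sup>2 * A3 - 2 * S\<^sup>2 * S * A2 - 2 * (S\<^sup>2) ^ 2 * A1 - 2 * (S\<^sup>2) ^ 2 * S = A5 \<longleftrightarrow>
        A5 + 2 * S * A4 + 2 * S\<^sup>2 * A3 + 2 * S ^ 3 * A2 + 2 * S ^ 4 * A1 + 2 * S ^ 5 = 0"
      "A5 = 2 * S * A4 - 2 * S\<^sup>2 * A3 + 2 * S\<^sup>2 * S * A2 - 2 * (S\<^sup>2) ^ 2 * A1 + 2 * (S\<^sup>2) ^ 2 * S \<longleftrightarrow>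
        - A5 + 2 * S * A4 + 2 * S\<^sup>2 * (- A3) + 2 * S ^ 3 * A2 + 2 * S ^ 4 * (- A1) + 2 * S ^ 5 = 0"
      by (auto simp: algebra_simps eval_nat_numeral)
    show ?thesis
      unfolding eq_def S_def[symmetric] unfolding QS z4 z3 z2 z1 z0
      unfolding T_def trace_bounds_def list.set bex_Un by blast
  qed

  have cbc: "cb \<and> cc \<longleftrightarrow> Delta \<le> 0"
  proof -
    define D where "D = 4 * A1 ^ 2 + 50 * Q - 10 * A2"
    have "D = - 100 / 3 * u2" by (simp add: D_def u2_def field_simps)
    from discriminant_iff_bounds[OF this, of u3]
    have "Delta \<le> 0 \<longleftrightarrow> 0 \<le> D \<and> \<bar>10 * u3\<bar> \<le> 1 / 50 * D powr (3 / 2)"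
      unfolding Delta_def .
    moreover have "10 * u3 = A3 - (- 4 / 25 * A1 ^ 3 + 3 / 5 * A1 * A2 + Q * A1)"
      by (simp add: u3_def)
    moreover have "cb \<longleftrightarrow> 0 \<le> D" unfolding cb_def D_def by auto
    ultimately show ?thesis unfolding cc_def D_def[symmetric] by (simp only: abs_le_iff) linarith
  qed

  have thetas: "theta k \<in> \<real>" "real_rooted P \<longleftrightarrow> thetas ! 0 \<le> u4 \<and> u4 \<le> thetas ! 1"
    if disc: "Delta \<le> 0" for k
  proof -
    note c = cardano_thetas[OF zt sd[unfolded Delta_def] omega disc[unfolded Delta_def]]
    show "theta k \<in> \<real>" unfolding theta_def by (rule c(1))
    show "real_rooted P \<longleftrightarrow> thetas ! 0 \<le> u4 \<and> u4 \<le> thetas ! 1"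
      unfolding P_def thetas_def theta_def by (rule c(2))
  qed
  \<comment> \<open>Condition (e) is the interval for \<open>5 * u4\<close> solved for
    \<open>a4\<close>.\<close>
  have ce_iff: "ce \<longleftrightarrow> thetas ! 0 \<le> u4 \<and> u4 \<le> thetas ! 1"
    unfolding ce_def u4_def by (auto simp: field_simps)
  have gammas: "\<forall>i1\<in>{1, -1}. \<forall>i2\<in>{1, -1}. x i1 i2 \<in> \<real>" "real_rooted F \<longleftrightarrow> ch" if "real_rooted P"
  proof -
    have t': "\<forall>i\<in>{1, -1}. (t i)\<^sup>2 = - complex_of_real u2 + of_int i * r"
      and s': "\<forall>i\<in>{1, -1}. (s i)\<^sup>2 = - 4 * complex_of_real u2 - 2 * y
        - of_int i * 8 * complex_of_real u3 / sq2y"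
      using t s unfolding is_sqrt_def by blast+
    have r': "r\<^sup>2 = complex_of_real (u2 ^ 2 - u4)"
      and w': "w\<^sup>2 = complex_of_real (v3 ^ 2 + 4 / 27 * v2 ^ 3)"
      and z': "sq2y\<^sup>2 = 2 * y"
      using r w sq2y unfolding is_sqrt_def by blast+
    note g = ferrari_gammas[OF r' t' w'[unfolded v2_def v3_def] C[unfolded v2_def v3_def]
      z'[unfolded y_def v2_def] s'[unfolded y_def v2_def] that[unfolded P_def]]
    show "\<forall>i1\<in>{1, -1}. \<forall>i2\<in>{1, -1}. x i1 i2 \<in> \<real>" unfolding x_def by (rule g(1))
    have "real_rooted F \<longleftrightarrow> max (H (gammas ! 0)) (H (gammas ! 2)) \<le> A5 - A \<and>
        A5 - A \<le> min (H (gammas ! 1)) (H (gammas ! 3))"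
      unfolding F_def H_def gammas_def x_def by (rule g(2))
    then show "real_rooted F \<longleftrightarrow> ch"
      unfolding ch_def Lam1_def Lam2_def by (simp only: le_diff_eq diff_le_eq)
  qed

  \<comment> \<open>The criteria for \<open>P\<close> and \<open>F\<close> are available only once
    \<open>Delta \<le> 0\<close> and real-rootedness of \<open>P\<close> are known. From a Weil
    polynomial these come by descending through \<open>FP\<close> and \<open>PD\<close>; conversely
    (b) and (c), then (e), then (h) climb back up.\<close>
  have weil_iff: "weil_poly q 5 h \<longleftrightarrow> ca \<and> cbs \<and> cb \<and> cc \<and> cd \<and> ce \<and> cf \<and> cg \<and> ch"
    using weil_T fF FP PD T_nonneg cbc thetas(2) ce_iff gammas(2) by blast
  have 1: "(weil_poly q 5 h \<or> (ca \<and> cbs \<and> cb \<and> cc \<and> cd)) \<longrightarrow> (\<forall>k<3. theta k \<in> \<real>)"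
    using weil_iff cbc thetas(1) by blast
  have 2: "(weil_poly q 5 h \<or> (ca \<and> cbs \<and> cb \<and> cc \<and> cd \<and> ce \<and> cf)) \<longrightarrow>
      (\<forall>i1\<in>{1, -1}. \<forall>i2\<in>{1, -1}. x i1 i2 \<in> \<real>)"
    using weil_iff cbc thetas(2) ce_iff gammas(1) by blast
  have 3: "weil_poly q 5 h \<longrightarrow> ((\<exists>z::real. poly (map_poly of_int h) z = 0) \<longleftrightarrow> eq)"
  proof
    assume W: "weil_poly q 5 h"
    then obtain c where c: "\<forall>i<5::nat. \<bar>c i\<bar> \<le> 2 * S" "f = (\<Prod>i<5. [:- c i, 1:])"
      using weil by blast
    have "map_poly real_of_int h = (\<Prod>i<5::nat. [:real q, - c i, 1:])"
      using c(2) hpoly_factors_iff[OF \<open>q > 0\<close>] unfolding h_def f_def by blast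
    then have "(\<exists>z::real. poly (map_poly of_int h) z = 0) \<longleftrightarrow> (\<exists>i<5. c i = 2 * S \<or> c i = - 2 * S)"
      using poly_factors_eq_0_iff[OF \<open>q > 0\<close>, of 5 c] c(1) unfolding S_def Q_def by auto
    also have "\<dots> \<longleftrightarrow> (\<exists>t\<in>T. t = 0)" using T(2)[OF c(2)] c(1) by blast
    also have "\<dots> \<longleftrightarrow> eq" using T_zero T(1)[OF c(2)] c(1) by blast
    finally show "(\<exists>z::real. poly (map_poly of_int h) z = 0) \<longleftrightarrow> eq" .
  qed
  have "\<not> (caseI \<and> caseII)" unfolding caseI_def caseII_def by blast
  moreover have "weil_poly q 5 h \<and> (\<exists>z::real. poly (map_poly of_int h) z = 0) \<longleftrightarrow> caseI \<or> caseII"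
    unfolding h_def caseI_def caseII_def by (rule weil_hpoly_real_root_iff) fact
  ultimately show ?thesis using 1 2 3 weil_iff by blast
qed

end
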